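(* Let $n\ge1$, $\mathfrak{gl}=\mathfrak{gl}(2n+1|2n)$ and $\mathfrak g=\mathfrak{osp}(2n+1|2n)\subset\mathfrak{gl}$ as in the context, with $f=\sum_{i=1}^{2n}F_{i+1,i}$ (viewed in both $\mathfrak g$ and $\mathfrak{gl}$). Let $\kappa:\mathcal V(\overline{\mathfrak{gl}})\to\mathcal V(\bar{\mathfrak g})$ be the differential algebra homomorphism induced by the projection $\mathfrak{gl}=\mathfrak{gl}^{\theta}\oplus\mathfrak{gl}^{-\theta}\to\mathfrak{gl}^\theta=\mathfrak g$, $X\mapsto\frac12(X+\theta(X))$ (so $\overline{X}\mapsto\overline{\tfrac12(X+\theta X)}$), where $\mathfrak{gl}^{\pm\theta}=\{X:\theta(X)=\pm X\}$. If $w\in\mathcal W(\overline{\mathfrak{gl}},f)$, then $\kappa(w)\in\mathcal W(\bar{\mathfrak g},f)$.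
   Context: $\mathfrak{gl}(2n+1|2n)$: index set $I=\{1,\dots,4n+1\}$, $p(i)=0$ for $i$ odd, $p(i)=1$ for $i$ even; matrix units $e_{ij}$ of parity $p(i)+p(j)$, $[e_{ij},e_{kl}]=\delta_{jk}e_{il}-(-1)^{(p(i)+p(j))(p(k)+p(l))}\delta_{il}e_{kj}$, $\operatorname{str}(\sum a_{ij}e_{ij})=\sum(-1)^{p(i)}a_{ii}$, form $(X|Y)=\operatorname{str}(XY)$. Put $i'=4n+2-i$, $\delta_k=1$ if $k\in\{2n+2,2n+4,\dots,4n\}$ and $\delta_k=0$ otherwise. $\theta$ is the linear map (an involutive automorphism of $\mathfrak{gl}$) with $\theta(e_{ij})=(-1)^{p(i)p(j)+p(j)+1+\delta_i+\delta_j}e_{j'i'}$; $F_{ij}=e_{ij}+\theta(e_{ij})$, and $\mathfrak g=\mathfrak{osp}(2n+1|2n)=\operatorname{span}\{F_{ij}\}=\mathfrak{gl}^\theta$, with form the restriction of $\operatorname{str}(XY)$. Gradings: $e_{ij}\in\mathfrak{gl}_{(j-i)/2}$, and $\mathfrak g_j=\mathfrak g\cap\mathfrak{gl}_j$ (so $F_{ij}\in\mathfrak g_{(j-i)/2}$); $f\in\mathfrak g_{-1/2}$ is odd. For $\mathfrak a$ with even supersymmetric invariant form, $\bar{\mathfrak a}$ is a parity-reversed copy ($p(\bar a)=p(a)+1$); $\mathcal V(\bar{\mathfrak a})=S(\mathbb C[D]\otimes\bar{\mathfrak a})$ is the free supercommutative algebra on $D^m\bar a$ with odd derivation $D$ and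 SUSY PVA bracket $\{\bar a{}_\chi\bar b\}=(-1)^{p(a)(p(b)+1)}\overline{[a,b]}+\chi(a|b)$ extended by sesquilinearity $\{Dx{}_\chi y\}=-\chi\{x{}_\chi y\}$, $\{x{}_\chi Dy\}=(-1)^{p(x)+1}(D+\chi)\{x{}_\chi y\}$ and Leibniz $\{x{}_\chi yz\}=(-1)^{(p(x)+1)p(y)}y\{x{}_\chi z\}+\{x{}_\chi y\}z$; $\chi$ odd, supercommuting with $\mathcal V$, $D\chi+\chi D=-2\chi^2$. For a grading $\mathfrak a=\bigoplus_j\mathfrak a_j$ and odd $f\in\mathfrak a_{-1/2}$: $\mathfrak n=\mathfrak a_{>0}$, $\mathfrak p=\mathfrak a_{\le0}$, $\mathfrak J$ = differential ideal of $\mathcal V(\bar{\mathfrak a})$ generated by $\bar n-(f|n)$ ($n\in\mathfrak n$), $\mathcal W(\bar{\mathfrak a},f)=\{w\in\mathcal V(\bar{\mathfrak p}):\{\bar n{}_\chi w\}\in\mathbb C[\chi]\otimes\mathfrak J\ \forall n\in\mathfrak n\}$. *)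

theory Defs
  imports Complex_Main "HOL-Library.Multiset" "HOL-Library.Product_Lexorder"
begin

definition Iset :: "nat \<Rightarrow> nat set" where
  "Iset n = {1..4*n+1}"

definition par :: "nat \<Rightarrow> nat" where
  "par i = (if even i then 1 else 0)"

definition prm :: "nat \<Rightarrow> nat \<Rightarrow> nat" where
  "prm n i = 4*n + 2 - i"

definition dlt :: "nat \<Rightarrow> nat \<Rightarrow> nat" where
  "dlt n k = (if even k \<and> 2*n+2 \<le> k \<and> k \<le> 4*n then 1 else 0)"

type_synonym mat = "nat \<Rightarrow> nat \<Rightarrow> complex"

definition gl :: "nat \<Rightarrow> mat set" where
  "gl n = {X. \<forall>i j. X i j \<noteq> 0 \<longrightarrow> i \<in> Iset n \<and> j \<in> Iset n}"

definition E :: "nat \<Rightarrow> nat \<Rightarrow> mat" where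
  "E i j = (\<lambda>k l. if k = i \<and> l = j then 1 else 0)"

definition tsign :: "nat \<Rightarrow> nat \<Rightarrow> nat \<Rightarrow> complex" where
  "tsign n i j = (-1) ^ (par i * par j + par j + 1 + dlt n i + dlt n j)"

text \<open>The linear map theta, theta(e_ij) = s_ij e_{j'i'}, on matrices:
  theta(X)_{kl} = s_{l'k'} X_{l'k'}.\<close>
definition theta :: "nat \<Rightarrow> mat \<Rightarrow> mat" where
  "theta n X = (\<lambda>k l. if k \<in> Iset n \<and> l \<in> Iset n
       then tsign n (prm n l) (prm n k) * X (prm n l) (prm n k) else 0)"

definition osp :: "nat \<Rightarrow> mat set" where
  "osp n = {X \<in> gl n. theta n X = X}"

definition F :: "nat \<Rightarrow> nat \<Rightarrow> nat \<Rightarrow> mat" where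
  "F n i j = (\<lambda>k l. E i j k l + theta n (E i j) k l)"

definition strf :: "nat \<Rightarrow> mat \<Rightarrow> mat \<Rightarrow> complex" where
  "strf n X Y = (\<Sum>i\<in>Iset n. (-1) ^ par i * (\<Sum>j\<in>Iset n. X i j * Y j i))"

definition fnil :: "nat \<Rightarrow> mat" where
  "fnil n = (\<lambda>k l. \<Sum>i\<in>{1..2*n}. F n (i+1) i k l)"

definition brE :: "nat \<Rightarrow> nat \<Rightarrow> nat \<Rightarrow> nat \<Rightarrow> mat" where
  "brE i j k l = (\<lambda>a b. (if j = k then E i l a b else 0)
      - (-1) ^ ((par i + par j) * (par k + par l)) * (if i = l then E k j a b else 0))"

text \<open>Grading: e_ij has degree (j-i)/2. n = positive part, p = nonpositive part.\<close>
definition posPart :: "nat \<Rightarrow> mat set \<Rightarrow> mat set" where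
  "posPart n A = {X \<in> A. \<forall>i j. X i j \<noteq> 0 \<longrightarrow> i < j}"

definition nonposPart :: "nat \<Rightarrow> mat set \<Rightarrow> mat set" where
  "nonposPart n A = {X \<in> A. \<forall>i j. X i j \<noteq> 0 \<longrightarrow> j \<le> i}"

text \<open>Generators: (i,j,m) stands for D^m (bar e_ij); its parity is
  p(i)+p(j)+1+m.  Elements of V are coefficient functions on monomials
  (multisets of generators, odd generators at most once); a monomial
  denotes the product of its generators in increasing (lexicographic) order.\<close>

type_synonym gen = "nat \<times> nat \<times> nat"
type_synonym mon = "gen multiset"
type_synonym V = "mon \<Rightarrow> complex"

definition gpar :: "gen \<Rightarrow> nat" where
  "gpar g = (case g of (i, j, m) \<Rightarrow> par i + par j + 1 + m)"

definition validm :: "mon \<Rightarrow> bool" where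
  "validm M = (\<forall>g. odd (gpar g) \<longrightarrow> count M g \<le> 1)"

definition mono :: "mon \<Rightarrow> V" where
  "mono M = (\<lambda>N. if N = M \<and> validm M then 1 else 0)"

definition vzero :: V where "vzero = (\<lambda>_. 0)"
definition vone :: V where "vone = mono {#}"
definition vadd :: "V \<Rightarrow> V \<Rightarrow> V" where "vadd P Q = (\<lambda>M. P M + Q M)"
definition vsmult :: "complex \<Rightarrow> V \<Rightarrow> V" where "vsmult c P = (\<lambda>M. c * P M)"
definition vsum :: "('a \<Rightarrow> V) \<Rightarrow> 'a set \<Rightarrow> V" where
  "vsum h A = (\<lambda>M. \<Sum>a\<in>A. h a M)"

text \<open>Sign produced by reordering the product of sorted monomials A and B.\<close>
definition msign :: "mon \<Rightarrow> mon \<Rightarrow> complex" where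
  "msign A B = (-1) ^ card {(x, y). x \<in># A \<and> y \<in># B \<and> odd (gpar x) \<and> odd (gpar y) \<and> y < x}"

definition vmult :: "V \<Rightarrow> V \<Rightarrow> V" where
  "vmult P Q = (\<lambda>M. if validm M
      then (\<Sum>A\<in>{A. A \<subseteq># M}. msign A (M - A) * P A * Q (M - A)) else 0)"

definition vgen :: "gen \<Rightarrow> V" where
  "vgen g = mono {#g#}"

fun prodl :: "gen list \<Rightarrow> V" where
  "prodl [] = vone"
| "prodl (g # gs) = vmult (vgen g) (prodl gs)"

definition Dg :: "gen \<Rightarrow> gen" where
  "Dg g = (case g of (i, j, m) \<Rightarrow> (i, j, Suc m))"

fun Dl :: "gen list \<Rightarrow> V" where
  "Dl [] = vzero"
| "Dl (g # gs) = vadd (vmult (vgen (Dg g)) (prodl gs))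
                      (vsmult ((-1) ^ gpar g) (vmult (vgen g) (Dl gs)))"

definition supp :: "V \<Rightarrow> mon set" where
  "supp P = {M. P M \<noteq> 0}"

definition DV :: "V \<Rightarrow> V" where
  "DV P = vsum (\<lambda>M. vsmult (P M) (Dl (sorted_list_of_multiset M))) (supp P)"

definition barD :: "nat \<Rightarrow> nat \<Rightarrow> mat \<Rightarrow> V" where
  "barD n m X = vsum (\<lambda>(i, j). vsmult (X i j) (vgen (i, j, m))) (Iset n \<times> Iset n)"

abbreviation barV :: "nat \<Rightarrow> mat \<Rightarrow> V" where
  "barV n X \<equiv> barD n 0 X"

inductive_set subalg :: "V set \<Rightarrow> V set" for S :: "V set" where
  sa_one: "vone \<in> subalg S"
| sa_gen: "s \<in> S \<Longrightarrow> s \<in> subalg S"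
| sa_add: "x \<in> subalg S \<Longrightarrow> y \<in> subalg S \<Longrightarrow> vadd x y \<in> subalg S"
| sa_smult: "x \<in> subalg S \<Longrightarrow> vsmult c x \<in> subalg S"
| sa_mult: "x \<in> subalg S \<Longrightarrow> y \<in> subalg S \<Longrightarrow> vmult x y \<in> subalg S"

text \<open>V(bar a) for a subspace a of gl (viewed inside V(bar gl)): the
  subalgebra generated by all D^m bar X, X in a.\<close>
definition Valg :: "nat \<Rightarrow> mat set \<Rightarrow> V set" where
  "Valg n A = subalg {barD n m X | m X. X \<in> A}"

inductive_set dideal :: "V set \<Rightarrow> V set \<Rightarrow> V set" for R G :: "V set" where
  di_gen: "g \<in> G \<Longrightarrow> g \<in> dideal R G"
| di_zero: "vzero \<in> dideal R G"
| di_add: "x \<in> dideal R G \<Longrightarrow> y \<in> dideal R G \<Longrightarrow> vadd x y \<in> dideal R G"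
| di_lmult: "a \<in> R \<Longrightarrow> x \<in> dideal R G \<Longrightarrow> vmult a x \<in> dideal R G"
| di_rmult: "a \<in> R \<Longrightarrow> x \<in> dideal R G \<Longrightarrow> vmult x a \<in> dideal R G"
| di_D: "x \<in> dideal R G \<Longrightarrow> DV x \<in> dideal R G"

definition Jid :: "nat \<Rightarrow> mat set \<Rightarrow> mat set \<Rightarrow> V set" where
  "Jid n A N = dideal (Valg n A)
      {vadd (barV n X) (vsmult (- strf n (fnil n) X) vone) | X. X \<in> N}"

text \<open>Elements of C[chi] (x) V: u k is the coefficient of chi^k (chi written on the left).\<close>
type_synonym CV = "nat \<Rightarrow> V"

definition cadd :: "CV \<Rightarrow> CV \<Rightarrow> CV" where "cadd u v = (\<lambda>k. vadd (u k) (v k))"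
definition csmult :: "complex \<Rightarrow> CV \<Rightarrow> CV" where "csmult c u = (\<lambda>k. vsmult c (u k))"
definition czero :: CV where "czero = (\<lambda>_. vzero)"

text \<open>(D + chi) on C[chi] (x) V, using D chi + chi D = -2 chi^2
  (hence D(chi^(2j) v) = chi^(2j) Dv, D(chi^(2j+1) v) = - chi^(2j+1) Dv - 2 chi^(2j+2) v).\<close>
definition Dchi :: "CV \<Rightarrow> CV" where
  "Dchi u = (\<lambda>k. vadd (vsmult ((-1) ^ k) (DV (u k)))
      (if k = 0 then vzero else vsmult (if odd (k - 1) then -1 else 1) (u (k - 1))))"

text \<open>Left multiplication by a homogeneous y of parity py (chi supercommutes
  with V) and right multiplication.\<close>
definition lmul :: "V \<Rightarrow> nat \<Rightarrow> CV \<Rightarrow> CV" where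
  "lmul y py u = (\<lambda>k. vsmult ((-1) ^ (py * k)) (vmult y (u k)))"
definition rmul :: "CV \<Rightarrow> V \<Rightarrow> CV" where
  "rmul u z = (\<lambda>k. vmult (u k) z)"

definition br0 :: "nat \<Rightarrow> nat \<times> nat \<Rightarrow> nat \<times> nat \<Rightarrow> CV" where
  "br0 n a b = (case a of (i, j) \<Rightarrow> case b of (k, l) \<Rightarrow>
     (\<lambda>d. if d = 0 then vsmult ((-1) ^ ((par i + par j) * (par k + par l + 1))) (barV n (brE i j k l))
          else if d = 1 then vsmult (strf n (E i j) (E k l)) vone
          else vzero))"

text \<open>{bar a _chi D^m bar b} via sesquilinearity (p(bar a) + 1 = p(a)).\<close>
definition brg :: "nat \<Rightarrow> nat \<times> nat \<Rightarrow> gen \<Rightarrow> CV" where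
  "brg n a g = (case a of (i, j) \<Rightarrow> case g of (k, l, m) \<Rightarrow>
     ((\<lambda>u. csmult ((-1) ^ (par i + par j)) (Dchi u)) ^^ m) (br0 n (i, j) (k, l)))"

text \<open>Leibniz rule along an ordered product of generators.\<close>
fun brl :: "nat \<Rightarrow> nat \<times> nat \<Rightarrow> gen list \<Rightarrow> CV" where
  "brl n a [] = czero"
| "brl n a (g # gs) = cadd
      (csmult ((-1) ^ ((par (fst a) + par (snd a)) * gpar g)) (lmul (vgen g) (gpar g) (brl n a gs)))
      (rmul (brg n a g) (prodl gs))"

definition LBr :: "nat \<Rightarrow> mat \<Rightarrow> V \<Rightarrow> CV" where
  "LBr n X w = (\<lambda>d. vsum (\<lambda>(i, j). vsmult (X i j)
       (vsum (\<lambda>M. vsmult (w M) (brl n (i, j) (sorted_list_of_multiset M) d)) (supp w)))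
     (Iset n \<times> Iset n))"

definition Wset :: "nat \<Rightarrow> mat set \<Rightarrow> V set" where
  "Wset n A = {w \<in> Valg n (nonposPart n A).
      \<forall>X \<in> posPart n A. \<forall>d. LBr n X w d \<in> Jid n A (posPart n A)}"

definition kgen :: "nat \<Rightarrow> gen \<Rightarrow> V" where
  "kgen n g = (case g of (i, j, m) \<Rightarrow>
      barD n m (\<lambda>k l. (1/2) * (E i j k l + theta n (E i j) k l)))"

fun kl :: "nat \<Rightarrow> gen list \<Rightarrow> V" where
  "kl n [] = vone"
| "kl n (g # gs) = vmult (kgen n g) (kl n gs)"

definition kappa :: "nat \<Rightarrow> V \<Rightarrow> V" where
  "kappa n w = vsum (\<lambda>M. vsmult (w M) (kl n (sorted_list_of_multiset M))) (supp w)"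

end

theory Submission
  imports Defs
begin

text \<open>
  The map \<open>kappa\<close> is a homomorphism of differential algebras, and for \<open>X\<close> in \<open>osp n\<close> it
  intertwines the bracket with \<open>X\<close>: on generators this says that theta is an automorphism
  fixing \<open>X\<close> and preserving the form, so that the projection commutes with \<open>[X, _]\<close> and
  does not change \<open>(X|_)\<close>; it extends to products because both sides are derivations along
  \<open>kappa\<close>. Since \<open>(f|n)\<close> only depends on the projection of \<open>n\<close>, \<open>kappa\<close> also maps the
  ideal J of gl into that of osp.
\<close>

section \<open>The supercommutative algebra of polynomials\<close>

text \<open>\<open>kappa\<close> does not respect the bracket in general: two elements of the
  (-1)-eigenspace of theta are projected to 0, while their bracket lies in the fixed part.
  Compatibility holds once the first argument is fixed by theta. That is enough, because the
  positive part of \<open>osp n\<close> lies inside that of \<open>gl n\<close>, so the condition on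
  \<open>w\<close> may be tested at fixed \<open>X\<close> only. The formal obstacle is that
  \<open>DV\<close>, \<open>kappa\<close> and \<open>LBr\<close> are sums over sorted monomials in
  matrix units. Products of sorted words are not sorted, and \<open>kappa\<close> turns a generator
  into a combination of generators. The maps are therefore first freed from the ordering, up to the
  Koszul sign, and their Leibniz rules are then restated for left factors \<open>barD n m X\<close>
  with \<open>X\<close> homogeneous. As chi is odd, the coefficient of chi^d behaves as a derivation
  whose parity depends on \<open>d\<close>, so all sign bookkeeping is done coefficient by
  coefficient.\<close>

lemma finite_submultisets [simp]: "finite {A. A \<subseteq># (M::'a multiset)}"
proof -
  have "{A. A \<subseteq># M} \<subseteq> (\<Union>k\<le>size M. multisets_of_size (set_mset M) k)"
    by (auto simp: multisets_of_size_def dest: size_mset_mono set_mset_mono)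
  then show ?thesis
    by (rule finite_subset) auto
qed

lemma mset_diff_diff: "A \<subseteq># M \<Longrightarrow> M - (M - A) = (A::'a multiset)"
  by (auto simp: multiset_eq_iff subseteq_mset_def)

lemma minus_one_power_cong: "even (a + b) \<Longrightarrow> (-1::complex) ^ a = (-1) ^ b"
  by (auto simp: minus_one_power_iff)

section \<open>Parity of monomials and the sign of a product\<close>

definition oddpart :: "mon \<Rightarrow> gen set" where
  "oddpart M = {g \<in> set_mset M. odd (gpar g)}"

definition mpar :: "mon \<Rightarrow> nat" where
  "mpar M = (\<Sum>g\<in>#M. gpar g)"

lemma mpar_simps [simp]: "mpar {#} = 0" "mpar (add_mset g M) = gpar g + mpar M"
  "mpar (A + B) = mpar A + mpar B"
  by (auto simp: mpar_def)

lemma finite_oddpart [simp]: "finite (oddpart M)"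
  by (simp add: oddpart_def)

lemma validm_empty [simp]: "validm {#}"
  by (simp add: validm_def)

lemma validm_single [simp]: "validm {#g#}"
  by (simp add: validm_def)

lemma validm_addD: "validm (A + B) \<Longrightarrow> validm A" "validm (A + B) \<Longrightarrow> validm B"
  unfolding validm_def by (metis add_leD1 add_leD2 count_union)+

lemma validm_mono: "validm M \<Longrightarrow> A \<subseteq># M \<Longrightarrow> validm A"
  by (metis subset_mset.add_diff_inverse validm_addD(1))

lemma oddpart_disjoint: "validm (A + B) \<Longrightarrow> oddpart A \<inter> oddpart B = {}"
proof (rule ccontr)
  assume v: "validm (A + B)" and "oddpart A \<inter> oddpart B \<noteq> {}"
  then obtain g where g: "odd (gpar g)" "g \<in># A" "g \<in># B"
    by (auto simp: oddpart_def)
  then have "count A g > 0" "count B g > 0"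
    by simp_all
  moreover have "count (A + B) g \<le> 1"
    using v g(1) unfolding validm_def by blast
  ultimately show False
    unfolding count_union by linarith
qed

lemma oddpart_add: "oddpart (A + B) = oddpart A \<union> oddpart B"
  by (auto simp: oddpart_def)

text \<open>In a valid monomial an odd generator occurs only once, so the set \<open>oddpart\<close>
  misses no odd factor, and even generators do not affect the parity.\<close>

lemma even_card_oddpart: "validm M \<Longrightarrow> even (card (oddpart M) + mpar M)"
proof (induction M)
  case (add g M)
  have "validm ({#g#} + M)"
    using add.prems by simp
  then have v: "validm M" and d: "oddpart {#g#} \<inter> oddpart M = {}"
    using validm_addD oddpart_disjoint by blast+
  have "oddpart (add_mset g M) = oddpart {#g#} \<union> oddpart M"
    by (metis add_mset_add_single oddpart_add sup_commute)
  with d have "card (oddpart (add_mset g M)) = card (oddpart {#g#}) + card (oddpart M)"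
    by (simp add: card_Un_disjoint)
  moreover have "card (oddpart {#g#}) = (if odd (gpar g) then 1 else 0)"
    by (auto simp: oddpart_def Collect_conv_if)
  ultimately show ?case
    using add.IH[OF v] by auto
qed (simp add: oddpart_def)

definition inv_pairs :: "mon \<Rightarrow> mon \<Rightarrow> (gen \<times> gen) set" where
  "inv_pairs A B = {(x, y). x \<in> oddpart A \<and> y \<in> oddpart B \<and> y < x}"

lemma msign_alt: "msign A B = (-1) ^ card (inv_pairs A B)"
  unfolding msign_def inv_pairs_def oddpart_def
  by (rule arg_cong[of _ _ "\<lambda>S. (-1) ^ card S"]) auto

lemma finite_inv_pairs [simp]: "finite (inv_pairs A B)"
  by (rule finite_subset[of _ "oddpart A \<times> oddpart B"]) (auto simp: inv_pairs_def)

lemma msign_add_right: "validm (B + C) \<Longrightarrow> msign A (B + C) = msign A B * msign A C"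
proof -
  assume "validm (B + C)"
  then have "inv_pairs A B \<inter> inv_pairs A C = {}"
    using oddpart_disjoint by (auto simp: inv_pairs_def)
  moreover have "inv_pairs A (B + C) = inv_pairs A B \<union> inv_pairs A C"
    by (auto simp: inv_pairs_def oddpart_add)
  ultimately show ?thesis
    by (simp add: msign_alt card_Un_disjoint power_add)
qed

lemma msign_add_left: "validm (A + B) \<Longrightarrow> msign (A + B) C = msign A C * msign B C"
proof -
  assume "validm (A + B)"
  then have "inv_pairs A C \<inter> inv_pairs B C = {}"
    using oddpart_disjoint by (auto simp: inv_pairs_def)
  moreover have "inv_pairs (A + B) C = inv_pairs A C \<union> inv_pairs B C"
    by (auto simp: inv_pairs_def oddpart_add)
  ultimately show ?thesis
    by (simp add: msign_alt card_Un_disjoint power_add)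
qed

text \<open>Validity excludes ties, so a pair of odd generators from \<open>A\<close> and
  \<open>B\<close> is an inversion in exactly one of the two orders. The two inversion counts thus
  add up to the product of the numbers of odd generators.\<close>

lemma msign_swap:
  assumes "validm (A + B)"
  shows "msign A B = (-1) ^ (mpar A * mpar B) * msign B A"
proof -
  have d: "oddpart A \<inter> oddpart B = {}"
    by (rule oddpart_disjoint[OF assms])
  have "card (inv_pairs B A) = card (prod.swap ` inv_pairs B A)"
    by (simp add: card_image)
  moreover have "inv_pairs A B \<inter> prod.swap ` inv_pairs B A = {}"
    by (auto simp: inv_pairs_def)
  moreover have "oddpart A \<times> oddpart B = inv_pairs A B \<union> prod.swap ` inv_pairs B A"
  proof
    show "oddpart A \<times> oddpart B \<subseteq> inv_pairs A B \<union> prod.swap ` inv_pairs B A"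
    proof (rule subsetI)
      fix z assume "z \<in> oddpart A \<times> oddpart B"
      then obtain x y where z: "z = (x, y)" "x \<in> oddpart A" "y \<in> oddpart B"
        by blast
      with d have "x \<noteq> y"
        by blast
      then consider "x < y" | "y < x"
        by (rule linorder_neqE)
      then show "z \<in> inv_pairs A B \<union> prod.swap ` inv_pairs B A"
      proof cases
        case 1
        then have "(y, x) \<in> inv_pairs B A"
          using z unfolding inv_pairs_def by blast
        then have "prod.swap (y, x) \<in> prod.swap ` inv_pairs B A"
          by (rule imageI)
        then show ?thesis
          using z by simp
      next
        case 2
        then show ?thesis
          using z unfolding inv_pairs_def by blast
      qed
    qed
  qed (auto simp: inv_pairs_def)
  ultimately have "card (inv_pairs A B) + card (inv_pairs B A) = card (oddpart A) * card (oddpart B)"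
    by (metis card_Un_disjoint card_cartesian_product finite_imageI finite_inv_pairs)
  moreover have "even (card (oddpart A) + mpar A)" "even (card (oddpart B) + mpar B)"
    using even_card_oddpart validm_addD[OF assms] by auto
  ultimately have "even (card (inv_pairs A B) + (mpar A * mpar B + card (inv_pairs B A)))"
    by (metis (no_types, opaque_lifting) add.assoc add.commute even_add even_mult_iff)
  from minus_one_power_cong[OF this] show ?thesis
    by (simp add: msign_alt power_add)
qed

lemma msign_simps [simp]: "msign {#} B = 1" "msign A {#} = 1"
  by (auto simp: msign_def)

section \<open>Bilinearity, unit, associativity and supercommutativity\<close>

lemmas v_defs = vadd_def vsmult_def vzero_def vsum_def

lemma vmult_vadd_left: "vmult (vadd P Q) R = vadd (vmult P R) (vmult Q R)"
  by (rule ext) (auto simp: vmult_def v_defs algebra_simps sum.distrib)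

lemma vmult_vadd_right: "vmult R (vadd P Q) = vadd (vmult R P) (vmult R Q)"
  by (rule ext) (auto simp: vmult_def v_defs algebra_simps sum.distrib)

lemma vmult_vsmult_left: "vmult (vsmult c P) R = vsmult c (vmult P R)"
  by (rule ext) (auto simp: vmult_def v_defs algebra_simps sum_distrib_left)

lemma vmult_vsmult_right: "vmult R (vsmult c P) = vsmult c (vmult R P)"
  by (rule ext) (auto simp: vmult_def v_defs algebra_simps sum_distrib_left)

lemma vmult_vzero [simp]: "vmult vzero R = vzero" "vmult R vzero = vzero"
  by (rule ext, auto simp: vmult_def v_defs)+

lemma vmult_vsum_left: "vmult (vsum h S) R = vsum (\<lambda>a. vmult (h a) R) S"
proof (rule ext)
  fix M
  have "(\<Sum>A\<in>{A. A \<subseteq># M}. msign A (M - A) * (\<Sum>a\<in>S. h a A) * R (M - A))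
      = (\<Sum>a\<in>S. \<Sum>A\<in>{A. A \<subseteq># M}. msign A (M - A) * h a A * R (M - A))"
    unfolding sum_distrib_left sum_distrib_right by (rule sum.swap)
  then show "vmult (vsum h S) R M = vsum (\<lambda>a. vmult (h a) R) S M"
    by (simp add: vmult_def vsum_def)
qed

lemma vmult_vsum_right: "vmult R (vsum h S) = vsum (\<lambda>a. vmult R (h a)) S"
proof (rule ext)
  fix M
  have "(\<Sum>A\<in>{A. A \<subseteq># M}. msign A (M - A) * R A * (\<Sum>a\<in>S. h a (M - A)))
      = (\<Sum>a\<in>S. \<Sum>A\<in>{A. A \<subseteq># M}. msign A (M - A) * R A * h a (M - A))"
    unfolding sum_distrib_left by (rule sum.swap)
  then show "vmult R (vsum h S) M = vsum (\<lambda>a. vmult R (h a)) S M"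
    by (simp add: vmult_def vsum_def)
qed

lemmas vmult_bilinear = vmult_vadd_left vmult_vadd_right vmult_vsmult_left vmult_vsmult_right

text \<open>\<open>vmult\<close> discards invalid monomials, so \<open>vone\<close> acts as a unit
  only on elements supported on valid ones.\<close>

definition vsupp :: "V \<Rightarrow> bool" where
  "vsupp P \<longleftrightarrow> (\<forall>M. P M \<noteq> 0 \<longrightarrow> validm M)"

lemma vmult_vone_left: "vsupp P \<Longrightarrow> vmult vone P = P"
proof (rule ext)
  fix M assume P: "vsupp P"
  have "(\<Sum>A\<in>{A. A \<subseteq># M}. msign A (M - A) * vone A * P (M - A))
      = (\<Sum>A\<in>{A. A \<subseteq># M}. if A = {#} then P M else 0)"
    by (rule sum.cong) (auto simp: vone_def mono_def)
  then show "vmult vone P M = P M"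
    using P by (auto simp: vmult_def vsupp_def)
qed

lemma vmult_vone_right: "vsupp P \<Longrightarrow> vmult P vone = P"
proof (rule ext)
  fix M assume P: "vsupp P"
  have "(\<Sum>A\<in>{A. A \<subseteq># M}. msign A (M - A) * P A * vone (M - A))
      = (\<Sum>A\<in>{A. A \<subseteq># M}. if A = M then P M else 0)"
    by (rule sum.cong) (auto simp: vone_def mono_def dest: subset_mset.antisym[OF _ Diff_eq_empty_iff_mset[THEN iffD1]])
  then show "vmult P vone M = P M"
    using P by (auto simp: vmult_def vsupp_def)
qed

text \<open>Both sides run over the splittings of \<open>M\<close> into three pieces
  \<open>A\<close>, \<open>B\<close>, \<open>D\<close>, and the signs agree by the cocycle identity
  \<open>msign (A + B) D * msign A B = msign A (B + D) * msign B D\<close>.\<close>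

lemma vmult_assoc: "vmult (vmult P Q) R = vmult P (vmult Q R)"
proof (rule ext)
  fix M
  show "vmult (vmult P Q) R M = vmult P (vmult Q R) M"
  proof (cases "validm M")
    case True
    have "vmult (vmult P Q) R M = (\<Sum>C\<in>{C. C \<subseteq># M}. \<Sum>A\<in>{A. A \<subseteq># C}.
        msign C (M - C) * (msign A (C - A) * P A * Q (C - A)) * R (M - C))"
      using True validm_mono[OF True]
      by (auto simp: vmult_def sum_distrib_left sum_distrib_right intro!: sum.cong)
    also have "\<dots> = (\<Sum>(C, A)\<in>(SIGMA C:{C. C \<subseteq># M}. {A. A \<subseteq># C}).
        msign C (M - C) * (msign A (C - A) * P A * Q (C - A)) * R (M - C))"
      by (rule sum.Sigma) auto
    also have "\<dots> = (\<Sum>(A, B)\<in>(SIGMA A:{A. A \<subseteq># M}. {B. B \<subseteq># M - A}).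
        msign A (M - A) * P A * (msign B (M - A - B) * Q B * R (M - A - B)))"
    proof (rule sum.reindex_bij_witness[where i = "\<lambda>(A, B). (A + B, A)" and j = "\<lambda>(C, A). (A, C - A)"], goal_cases)
      case (5 x)
      obtain C A where x: "x = (C, A)" by force
      with 5 have s: "A \<subseteq># C" "C \<subseteq># M" by auto
      define B D where "B = C - A" and "D = M - C"
      have C: "C = A + B" and M: "M = A + B + D"
        using s by (auto simp: B_def D_def)
      have "validm (A + B)" "validm (B + D)"
        using True validm_addD M by (metis add.assoc)+
      then have "msign A (B + D) * msign B D = msign (A + B) D * msign A B"
        by (simp add: msign_add_left msign_add_right)
      then show ?case
        by (simp add: x C M add.assoc mult_ac)
    next
      case (2 x)
      then obtain C A where x: "x = (C, A)" "A \<subseteq># C" "C \<subseteq># M"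
        by auto
      then have "C - A \<subseteq># M - A" "A \<subseteq># M"
        by (auto simp: subseteq_mset_def intro: diff_le_mono)
          (meson order_trans)
      with x show ?case
        by simp
    next
      case (4 x)
      then obtain A B where x: "x = (A, B)" "A \<subseteq># M" "B \<subseteq># M - A"
        by auto
      then have "A + B \<subseteq># M"
        by (metis subset_mset.add_diff_inverse subset_mset.add_left_mono)
      with x show ?case
        by simp
    qed auto
    also have "\<dots> = (\<Sum>A\<in>{A. A \<subseteq># M}. \<Sum>B\<in>{B. B \<subseteq># M - A}.
        msign A (M - A) * P A * (msign B (M - A - B) * Q B * R (M - A - B)))"
      by (rule sum.Sigma[symmetric]) auto
    also have "\<dots> = vmult P (vmult Q R) M"
      using True validm_mono[OF True diff_subset_eq_self]
      by (auto simp: vmult_def sum_distrib_left sum_distrib_right intro!: sum.cong)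
    finally show ?thesis .
  qed (simp add: vmult_def)
qed

definition homog :: "nat \<Rightarrow> V \<Rightarrow> bool" where
  "homog p P \<longleftrightarrow> (\<forall>M. P M \<noteq> 0 \<longrightarrow> even (mpar M + p))"

text \<open>Complementation in \<open>M\<close> matches the terms of the two sums; where the
  coefficients are nonzero, the parities of the two pieces are \<open>p\<close> and
  \<open>q\<close>, so \<open>msign_swap\<close> gives a uniform sign.\<close>

lemma vmult_supercomm:
  assumes "homog p P" "homog q Q"
  shows "vmult P Q = vsmult ((-1) ^ (p * q)) (vmult Q P)"
proof (rule ext)
  fix M
  have "(\<Sum>A\<in>{A. A \<subseteq># M}. msign A (M - A) * P A * Q (M - A)) =
      (\<Sum>A\<in>{A. A \<subseteq># M}. (-1) ^ (p * q) * (msign A (M - A) * Q A * P (M - A)))"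
    if v: "validm M"
  proof (rule sum.reindex_bij_witness[where i = "\<lambda>A. M - A" and j = "\<lambda>A. M - A"])
    fix A assume "A \<in> {A. A \<subseteq># M}"
    then have A: "A \<subseteq># M" by simp
    define B where "B = M - A"
    have M: "M = A + B"
      using A by (simp add: B_def)
    have "msign A B * P A * Q B = (-1) ^ (p * q) * (msign B A * Q B * P A)"
    proof (cases "P A = 0 \<or> Q B = 0")
      case False
      then have "even (mpar A + p)" "even (mpar B + q)"
        using assms by (auto simp: homog_def)
      then have "(-1::complex) ^ (mpar A * mpar B) = (-1) ^ (p * q)"
        by (intro minus_one_power_cong) auto
      then have e: "msign A B = (-1) ^ (p * q) * msign B A"
        using msign_swap[of A B] v M by simp
      show ?thesis
        unfolding e by (simp only: mult_ac)
    qed auto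
    from this[symmetric]
    show "(-1) ^ (p * q) * (msign (M - A) (M - (M - A)) * Q (M - A) * P (M - (M - A)))
        = msign A (M - A) * P A * Q (M - A)"
      unfolding M add_diff_cancel_left' add_diff_cancel_right' .
  qed (auto simp: mset_diff_diff)
  then show "vmult P Q M = vsmult ((-1) ^ (p * q)) (vmult Q P) M"
    by (simp add: vmult_def vsmult_def sum_distrib_left)
qed

lemma homog_vmult:
  assumes "homog p P" "homog q Q"
  shows "homog (p + q) (vmult P Q)"
  unfolding homog_def
proof (intro allI impI)
  fix M assume "vmult P Q M \<noteq> 0"
  then obtain A where "A \<subseteq># M" "P A \<noteq> 0" "Q (M - A) \<noteq> 0"
    unfolding vmult_def by (auto split: if_splits elim!: sum.not_neutral_contains_not_neutral)
  moreover from this have "mpar M = mpar A + mpar (M - A)"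
    by (metis mpar_simps(3) subset_mset.add_diff_inverse)
  ultimately show "even (mpar M + (p + q))"
    using assms by (fastforce simp: homog_def)
qed

lemma homog_vadd: "homog p P \<Longrightarrow> homog p Q \<Longrightarrow> homog p (vadd P Q)"
  unfolding homog_def vadd_def by (metis add.right_neutral)

lemma homog_vsmult: "homog p P \<Longrightarrow> homog p (vsmult c P)"
  by (auto simp: homog_def vsmult_def)

lemma homog_vzero [simp]: "homog p vzero"
  by (auto simp: homog_def vzero_def)

lemma homog_vsum: "(\<And>a. a \<in> S \<Longrightarrow> homog p (h a)) \<Longrightarrow> homog p (vsum h S)"
  unfolding homog_def vsum_def by (meson sum.not_neutral_contains_not_neutral)

lemma homog_cong: "homog p P \<Longrightarrow> even (p + q) \<Longrightarrow> homog q P"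
  by (fastforce simp: homog_def)

lemma homog_vgen: "homog (gpar g) (vgen g)"
  by (auto simp: homog_def vgen_def mono_def)

lemma homog_vone: "homog 0 vone"
  by (auto simp: homog_def vone_def mono_def)

section \<open>Well-defined linear extensions from words in the generators\<close>

text \<open>The type \<open>V\<close> also contains functions of infinite support, on which a sum
  over \<open>supp\<close> defaults to zero. Linearity of \<open>DV\<close>, \<open>kappa\<close>
  and \<open>LBr\<close> is therefore available only for finite support.\<close>

definition vpoly :: "V \<Rightarrow> bool" where
  "vpoly P \<longleftrightarrow> finite (supp P) \<and> vsupp P"

lemma vpoly_vzero [simp]: "vpoly vzero"
  by (simp add: vpoly_def supp_def vsupp_def vzero_def)

lemma vpoly_mono [simp]: "vpoly (mono M)"
proof -
  have "supp (mono M) \<subseteq> {M}"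
    by (auto simp: supp_def mono_def)
  then show ?thesis
    using finite_subset by (auto simp: vpoly_def vsupp_def mono_def)
qed

lemma vpoly_vone [simp]: "vpoly vone"
  by (simp add: vone_def)

lemma vpoly_vgen [simp]: "vpoly (vgen g)"
  by (simp add: vgen_def)

lemma vpoly_vadd [simp]: "vpoly P \<Longrightarrow> vpoly Q \<Longrightarrow> vpoly (vadd P Q)"
proof -
  assume "vpoly P" "vpoly Q"
  moreover have "supp (vadd P Q) \<subseteq> supp P \<union> supp Q"
    by (auto simp: supp_def vadd_def)
  ultimately show ?thesis
    by (auto simp: vpoly_def vsupp_def supp_def vadd_def intro: finite_subset)
qed

lemma vpoly_vsmult [simp]: "vpoly P \<Longrightarrow> vpoly (vsmult c P)"
proof -
  assume "vpoly P"
  moreover have "supp (vsmult c P) \<subseteq> supp P"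
    by (auto simp: supp_def vsmult_def)
  ultimately show ?thesis
    by (auto simp: vpoly_def vsupp_def vsmult_def intro: finite_subset)
qed

lemma vsum_infinite: "infinite S \<Longrightarrow> vsum h S = vzero"
  by (simp add: vsum_def vzero_def)

lemma vsum_empty [simp]: "vsum h {} = vzero"
  by (simp add: vsum_def vzero_def)

lemma vsum_insert [simp]: "finite S \<Longrightarrow> a \<notin> S \<Longrightarrow> vsum h (insert a S) = vadd (h a) (vsum h S)"
  by (simp add: vsum_def vadd_def)

lemma vsum_cong: "S = T \<Longrightarrow> (\<And>a. a \<in> T \<Longrightarrow> h a = k a) \<Longrightarrow> vsum h S = vsum k T"
  unfolding vsum_def by (rule ext) (auto intro: sum.cong)

lemma vsum_vzero [simp]: "vsum (\<lambda>a. vzero) S = vzero"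
  by (simp add: vsum_def vzero_def)

lemma vsmult_simps [simp]: "vsmult c vzero = vzero" "vsmult 0 P = vzero" "vsmult 1 P = P"
  "vsmult a (vsmult b P) = vsmult (a * b) P"
  by (auto simp: v_defs)

lemma vadd_vzero [simp]: "vadd vzero P = P" "vadd P vzero = P"
  by (auto simp: v_defs)

lemma vadd_commute: "vadd P Q = vadd Q P"
  by (auto simp: v_defs)

lemma vsmult_vadd: "vsmult c (vadd P Q) = vadd (vsmult c P) (vsmult c Q)"
  by (auto simp: v_defs algebra_simps)

lemma vpoly_vsum [simp]: "(\<And>a. a \<in> S \<Longrightarrow> vpoly (h a)) \<Longrightarrow> vpoly (vsum h S)"
proof (cases "finite S")
  case True
  then show "(\<And>a. a \<in> S \<Longrightarrow> vpoly (h a)) \<Longrightarrow> vpoly (vsum h S)"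
    by (induction S) auto
qed (simp add: vsum_infinite)

lemma vpoly_vmult [simp]:
  assumes "vpoly P" "vpoly Q"
  shows "vpoly (vmult P Q)"
proof -
  have "supp (vmult P Q) \<subseteq> (\<lambda>(A, B). A + B) ` (supp P \<times> supp Q)"
  proof
    fix M assume "M \<in> supp (vmult P Q)"
    then obtain A where "A \<subseteq># M" "P A \<noteq> 0" "Q (M - A) \<noteq> 0"
      unfolding supp_def vmult_def by (auto split: if_splits elim!: sum.not_neutral_contains_not_neutral)
    then show "M \<in> (\<lambda>(A, B). A + B) ` (supp P \<times> supp Q)"
      by (intro image_eqI[where x = "(A, M - A)"]) (auto simp: supp_def)
  qed
  moreover have "vsupp (vmult P Q)"
    by (auto simp: vsupp_def vmult_def split: if_splits)
  ultimately show ?thesis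
    using assms by (auto simp: vpoly_def intro: finite_subset)
qed

lemma vpoly_prodl [simp]: "vpoly (prodl gs)"
  by (induction gs) auto

lemma vmult_vone [simp]: "vpoly P \<Longrightarrow> vmult vone P = P" "vpoly P \<Longrightarrow> vmult P vone = P"
  by (simp_all add: vpoly_def vmult_vone_left vmult_vone_right)

text \<open>Prepending a least generator creates no inversion. If \<open>g\<close> is odd and
  already occurs in \<open>N\<close>, both sides vanish by invalidity.\<close>

lemma vmult_vgen_mono:
  assumes "\<And>x. x \<in># N \<Longrightarrow> g \<le> x"
  shows "vmult (vgen g) (mono N) = mono (add_mset g N)"
proof (rule ext)
  fix M
  have *: "msign A (M - A) * vgen g A * mono N (M - A)
      = (if A = {#g#} then (if M = add_mset g N \<and> validm N then 1 else 0) else 0)"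
    if "A \<subseteq># M" for A
  proof (cases "A = {#g#}")
    case True
    have "inv_pairs {#g#} N = {}"
      using assms by (auto simp: inv_pairs_def oddpart_def not_less)
    then have "msign {#g#} N = 1"
      by (simp add: msign_alt)
    moreover have "M - {#g#} = N \<longleftrightarrow> M = add_mset g N"
      using that True by auto
    ultimately show ?thesis
      using True by (auto simp: vgen_def mono_def)
  qed (auto simp: vgen_def mono_def)
  have "(\<Sum>A\<in>{A. A \<subseteq># M}. msign A (M - A) * vgen g A * mono N (M - A))
      = (\<Sum>A\<in>{A. A \<subseteq># M}. if A = {#g#} then (if M = add_mset g N \<and> validm N then 1 else 0) else 0)"
    using * by (intro sum.cong) blast+
  also have "\<dots> = (if {#g#} \<subseteq># M \<and> M = add_mset g N \<and> validm N then 1 else 0)"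
    by (subst sum.delta) auto
  finally have "(\<Sum>A\<in>{A. A \<subseteq># M}. msign A (M - A) * vgen g A * mono N (M - A))
      = (if {#g#} \<subseteq># M \<and> M = add_mset g N \<and> validm N then 1 else 0)" .
  moreover have "validm M \<Longrightarrow> M = add_mset g N \<Longrightarrow> validm N"
    using validm_addD[of "{#g#}" N] by simp
  ultimately show "vmult (vgen g) (mono N) M = mono (add_mset g N) M"
    by (auto simp: vmult_def mono_def)
qed

lemma prodl_sorted: "sorted gs \<Longrightarrow> prodl gs = mono (mset gs)"
proof (induction gs)
  case (Cons g gs)
  then show ?case
    using vmult_vgen_mono[of "mset gs" g] by simp
qed (simp add: vone_def)

text \<open>Sorted words already span; admitting all words in the \<open>prodl\<close> case lets
  later proofs continue by induction on the list.\<close>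

lemma vpoly_induct [consumes 1, case_names zero prodl add smult]:
  assumes "vpoly w" and "P vzero" and "\<And>gs. P (prodl gs)"
    and "\<And>x y. vpoly x \<Longrightarrow> vpoly y \<Longrightarrow> P x \<Longrightarrow> P y \<Longrightarrow> P (vadd x y)"
    and "\<And>c x. vpoly x \<Longrightarrow> P x \<Longrightarrow> P (vsmult c x)"
  shows "P w"
proof -
  let ?t = "\<lambda>M. vsmult (w M) (prodl (sorted_list_of_multiset M))"
  have "finite S \<Longrightarrow> vpoly (vsum ?t S) \<and> P (vsum ?t S)" for S
    by (induction S rule: finite_induct) (use assms in auto)
  moreover have "vsum ?t (supp w) = w"
  proof (rule ext)
    fix N
    have "vsum ?t (supp w) N = (\<Sum>M\<in>supp w. if M = N then w N else 0)"
      unfolding vsum_def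
    proof (rule sum.cong[OF refl])
      fix M assume "M \<in> supp w"
      \<comment> \<open>Only for valid \<open>M\<close> is the sorted product the basis vector of
        \<open>M\<close>; for invalid \<open>M\<close> it is zero.\<close>
      then have "validm M"
        using assms(1) by (auto simp: vpoly_def vsupp_def supp_def)
      then show "?t M N = (if M = N then w N else 0)"
        by (simp add: prodl_sorted) (auto simp: vsmult_def mono_def)
    qed
    then show "vsum ?t (supp w) N = w N"
      using assms(1) by (auto simp: vpoly_def supp_def)
  qed
  ultimately show ?thesis
    using assms(1) by (metis vpoly_def)
qed

text \<open>
  A function on words in the generators that changes by the Koszul sign under adjacent
  transpositions factors through the algebra: applied to a polynomial it may be evaluated on any
  words representing the monomials, not only on the sorted ones used in \<open>kappa\<close>, \<open>DV\<close> and \<open>LBr\<close>.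
\<close>

definition swapsym :: "(gen list \<Rightarrow> V) \<Rightarrow> bool" where
  "swapsym L \<longleftrightarrow> (\<forall>us g h vs. L (us @ g # h # vs) = vsmult ((-1) ^ (gpar g * gpar h)) (L (us @ h # g # vs)))"

lemma swapsym_Cons: "swapsym L \<Longrightarrow> swapsym (\<lambda>gs. L (g # gs))"
  unfolding swapsym_def by (metis append_Cons)

text \<open>The sign is chosen before \<open>L\<close>, so it depends on the word alone. This
  uniformity later allows the sign of \<open>prodl\<close> to be compared with that of any other
  \<open>L\<close>.\<close>

lemma swapsym_insort:
  "\<exists>c. (c = 1 \<or> c = -1) \<and> (\<forall>L. swapsym L \<longrightarrow> L (g # gs) = vsmult c (L (insort g gs)))"
proof (induction gs)
  case Nil
  show ?case
    by (intro exI[of _ 1]) simp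
next
  case (Cons h gs)
  then obtain c where c: "c = 1 \<or> c = -1" and s: "\<And>L. swapsym L \<Longrightarrow> L (g # gs) = vsmult c (L (insort g gs))"
    by blast
  show ?case
  proof (cases "g \<le> h")
    case True
    then show ?thesis
      by (intro exI[of _ 1]) simp
  next
    case False
    have "L (g # h # gs) = vsmult ((-1) ^ (gpar g * gpar h) * c) (L (insort g (h # gs)))" if L: "swapsym L" for L
    proof -
      have "L (g # h # gs) = vsmult ((-1) ^ (gpar g * gpar h)) (L (h # g # gs))"
        using L unfolding swapsym_def by (metis append_Nil)
      also have "L (h # g # gs) = vsmult c (L (h # insort g gs))"
        using s[OF swapsym_Cons[OF L]] .
      finally show ?thesis
        using False by simp
    qed
    then show ?thesis
      using c by (intro exI[of _ "(-1) ^ (gpar g * gpar h) * c"]) (auto simp: minus_one_power_iff)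
  qed
qed

lemma swapsym_sort:
  "\<exists>c. (c = 1 \<or> c = -1) \<and> (\<forall>L. swapsym L \<longrightarrow> L gs = vsmult c (L (sort gs)))"
proof (induction gs)
  case Nil
  show ?case
    by (intro exI[of _ 1]) simp
next
  case (Cons g gs)
  then obtain c where c: "c = 1 \<or> c = -1" and s: "\<And>L. swapsym L \<Longrightarrow> L gs = vsmult c (L (sort gs))"
    by blast
  obtain d where d: "d = 1 \<or> d = -1"
    and t: "\<And>L. swapsym L \<Longrightarrow> L (g # sort gs) = vsmult d (L (insort g (sort gs)))"
    using swapsym_insort[of g "sort gs"] by blast
  have "L (g # gs) = vsmult (c * d) (L (sort (g # gs)))" if L: "swapsym L" for L
    using s[OF swapsym_Cons[OF L]] t[OF L] by simp
  then show ?case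
    using c d by (intro exI[of _ "c * d"]) auto
qed

text \<open>Swapping two equal odd generators gives \<open>L = - L\<close>, the counterpart of the
  vanishing square of an odd element.\<close>

lemma swapsym_sort_invalid:
  assumes L: "swapsym L" and "\<not> validm (mset gs)"
  shows "L (sort gs) = vzero"
proof -
  obtain g where g: "odd (gpar g)" "count (mset gs) g \<ge> 2"
    using assms(2) unfolding validm_def by force
  have "replicate_mset 2 g \<subseteq># mset gs"
    using g(2) by (simp add: count_le_replicate_mset_subset_eq)
  then obtain R where R: "mset gs = {#g, g#} + R"
    by (metis add_mset_add_single mset_subset_eq_exists_conv numeral_2_eq_2 replicate_mset_Suc replicate_mset_0)
  obtain rs where "mset rs = R"
    using ex_mset by blast
  \<comment> \<open>Sorting depends only on the multiset, so the word may be replaced by one that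
    starts with the repeated generator.\<close>
  then have "mset gs = mset (g # g # rs)"
    using R by simp
  then have "sort gs = sort (g # g # rs)"
    using sorted_list_of_multiset_mset by metis
  moreover obtain c where c: "c = 1 \<or> c = -1" and s: "L (g # g # rs) = vsmult c (L (sort (g # g # rs)))"
    using swapsym_sort[of "g # g # rs"] L by blast
  moreover have "L (g # g # rs) = vsmult (-1) (L (g # g # rs))"
    using L[unfolded swapsym_def, rule_format, of "[]" g g rs] g(1) by simp
  then have "L (g # g # rs) = vzero"
    by (auto simp: v_defs fun_eq_iff)
  ultimately show ?thesis
    by (auto simp: v_defs fun_eq_iff)
qed

definition extV :: "(gen list \<Rightarrow> V) \<Rightarrow> V \<Rightarrow> V" where
  "extV L w = vsum (\<lambda>M. vsmult (w M) (L (sorted_list_of_multiset M))) (supp w)"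

text \<open>Supports can shrink under addition and scaling; a common finite index set makes the sums
  comparable.\<close>

lemma extV_superset:
  assumes "finite S" "supp w \<subseteq> S"
  shows "extV L w = vsum (\<lambda>M. vsmult (w M) (L (sorted_list_of_multiset M))) S"
  unfolding extV_def vsum_def
  by (rule ext, rule sum.mono_neutral_left) (use assms in \<open>auto simp: supp_def vsmult_def\<close>)

lemma extV_vadd:
  assumes "vpoly P" "vpoly Q"
  shows "extV L (vadd P Q) = vadd (extV L P) (extV L Q)"
proof -
  have f: "finite (supp P \<union> supp Q)"
    using assms by (simp add: vpoly_def)
  have "supp (vadd P Q) \<subseteq> supp P \<union> supp Q"
    by (auto simp: supp_def vadd_def)
  then show ?thesis
    using extV_superset[OF f, of _ L] by (auto simp: v_defs algebra_simps sum.distrib)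
qed

lemma extV_vsmult: "vpoly P \<Longrightarrow> extV L (vsmult c P) = vsmult c (extV L P)"
proof -
  assume "vpoly P"
  then have f: "finite (supp P)"
    by (simp add: vpoly_def)
  have "supp (vsmult c P) \<subseteq> supp P"
    by (auto simp: supp_def vsmult_def)
  then show ?thesis
    using extV_superset[OF f, of _ L] by (auto simp: v_defs algebra_simps sum_distrib_left)
qed

lemma extV_vzero [simp]: "extV L vzero = vzero"
  by (simp add: extV_def supp_def vzero_def)

lemma extV_vsum: "(\<And>a. a \<in> S \<Longrightarrow> vpoly (h a)) \<Longrightarrow> extV L (vsum h S) = vsum (\<lambda>a. extV L (h a)) S"
proof (cases "finite S")
  case True
  then show "(\<And>a. a \<in> S \<Longrightarrow> vpoly (h a)) \<Longrightarrow> extV L (vsum h S) = vsum (\<lambda>a. extV L (h a)) S"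
    by (induction S) (auto simp: extV_vadd)
qed (simp add: vsum_infinite)

lemma vpoly_extV: "(\<And>gs. vpoly (L gs)) \<Longrightarrow> vpoly (extV L w)"
  by (simp add: extV_def)

lemma swapsym_mult:
  assumes "\<And>g gs. L (g # gs) = vmult (a g) (L gs)" and "\<And>g. homog (gpar g) (a g)"
  shows "swapsym L"
  unfolding swapsym_def
proof (intro allI)
  fix us g h vs
  show "L (us @ g # h # vs) = vsmult ((-1) ^ (gpar g * gpar h)) (L (us @ h # g # vs))"
  proof (induction us)
    case Nil
    have "L (g # h # vs) = vmult (vmult (a g) (a h)) (L vs)"
      by (simp add: assms(1) vmult_assoc)
    also have "vmult (a g) (a h) = vsmult ((-1) ^ (gpar g * gpar h)) (vmult (a h) (a g))"
      by (intro vmult_supercomm assms(2))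
    finally show ?case
      by (simp add: assms(1) vmult_assoc vmult_bilinear)
  qed (simp add: assms(1) vmult_bilinear)
qed

lemma swapsym_prodl: "swapsym prodl"
  by (rule swapsym_mult[of _ vgen]) (auto simp: homog_vgen)

lemma extV_mono: "validm M \<Longrightarrow> extV L (mono M) = L (sorted_list_of_multiset M)"
proof -
  assume "validm M"
  then have "supp (mono M) = {M}" "mono M M = 1"
    by (auto simp: supp_def mono_def)
  then show ?thesis
    unfolding extV_def by simp
qed

text \<open>Sorting the word produces the same sign for \<open>prodl\<close> and for
  \<open>L\<close>. If the word repeats an odd generator, both sides are zero.\<close>

lemma extV_prodl:
  assumes L: "swapsym L"
  shows "extV L (prodl gs) = L gs"
proof -
  obtain c where c: "\<And>L. swapsym L \<Longrightarrow> L gs = vsmult c (L (sort gs))"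
    using swapsym_sort by blast
  have p: "prodl gs = vsmult c (mono (mset gs))"
    using c[OF swapsym_prodl] prodl_sorted[of "sort gs"] by simp
  show ?thesis
  proof (cases "validm (mset gs)")
    case True
    then show ?thesis
      using c[OF L] by (simp add: p extV_vsmult extV_mono)
  next
    case False
    then have "mono (mset gs) = vzero"
      by (auto simp: mono_def vzero_def)
    then show ?thesis
      using c[OF L] swapsym_sort_invalid[OF L False] by (simp add: p)
  qed
qed

text \<open>
  The Leibniz rule of a derivation of parity \<open>r\<close> with values \<open>b\<close> on generators. Both \<open>Dl\<close>
  (with \<open>r = 1\<close>) and every chi-coefficient \<open>d\<close> of \<open>brl\<close> (with \<open>r = p(a) + d\<close>, as chi is odd)
  are of this form.
\<close>

fun leib :: "nat \<Rightarrow> (gen \<Rightarrow> V) \<Rightarrow> gen list \<Rightarrow> V" where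
  "leib r b [] = vzero"
| "leib r b (g # gs) = vadd (vsmult ((-1) ^ (r * gpar g)) (vmult (vgen g) (leib r b gs)))
     (vmult (b g) (prodl gs))"

text \<open>Moving \<open>vgen g\<close> past \<open>b h\<close> costs an extra factor
  \<open>(-1) ^ (r * gpar g)\<close>, which is exactly the Leibniz sign. So the terms containing
  \<open>b g\<close> and \<open>b h\<close> trade places under the swap, each with the plain Koszul
  sign.\<close>

lemma swapsym_leib:
  assumes b: "\<And>g. homog (gpar g + r) (b g)"
  shows "swapsym (leib r b)"
  unfolding swapsym_def
proof (intro allI)
  fix us g h vs
  show "leib r b (us @ g # h # vs) = vsmult ((-1) ^ (gpar g * gpar h)) (leib r b (us @ h # g # vs))"
  proof (induction us)
    case Nil
    have c1: "vmult (vgen g) (vmult (vgen h) x) = vsmult ((-1) ^ (gpar g * gpar h)) (vmult (vgen h) (vmult (vgen g) x))" for x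
      using vmult_supercomm[OF homog_vgen homog_vgen, of g h]
      by (metis vmult_assoc vmult_vsmult_left)
    have c2: "vmult (vgen g) (vmult (b h) x) = vsmult ((-1) ^ (gpar g * (gpar h + r))) (vmult (b h) (vmult (vgen g) x))" for x
      using vmult_supercomm[OF homog_vgen b, of g h]
      by (metis vmult_assoc vmult_vsmult_left)
    have c3: "vmult (b g) (vmult (vgen h) x) = vsmult ((-1) ^ ((gpar g + r) * gpar h)) (vmult (vgen h) (vmult (b g) x))" for x
      using vmult_supercomm[OF b homog_vgen, of g h]
      by (metis vmult_assoc vmult_vsmult_left)
    show ?case
      by (simp add: vmult_bilinear vsmult_vadd c1 c2 c3)
         (auto simp: v_defs algebra_simps minus_one_power_iff fun_eq_iff)
  next
    case (Cons u us)
    have "prodl (us @ g # h # vs) = vsmult ((-1) ^ (gpar g * gpar h)) (prodl (us @ h # g # vs))"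
      using swapsym_prodl unfolding swapsym_def by blast
    then show ?case
      using Cons by (simp add: vmult_bilinear vsmult_vadd mult_ac)
  qed
qed

text \<open>This carries the Leibniz rule from words to an arbitrary polynomial right
  factor.\<close>

lemma extV_leib_mult:
  assumes b: "\<And>g. homog (gpar g + r) (b g)" and "vpoly Q"
  shows "extV (leib r b) (vmult (vgen g) Q)
    = vadd (vsmult ((-1) ^ (r * gpar g)) (vmult (vgen g) (extV (leib r b) Q))) (vmult (b g) Q)"
  using assms(2)
proof (induction rule: vpoly_induct)
  case (prodl gs)
  show ?case
    using extV_prodl[OF swapsym_leib[OF b], of "g # gs"] extV_prodl[OF swapsym_leib[OF b], of gs]
    by simp
next
  case (add x y)
  then show ?case
    by (simp add: vmult_bilinear extV_vadd) (auto simp: v_defs algebra_simps)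
next
  case (smult c x)
  then show ?case
    by (simp add: vmult_bilinear extV_vsmult) (auto simp: v_defs algebra_simps)
qed auto

lemma leib_vpoly: "(\<And>g. vpoly (b g)) \<Longrightarrow> vpoly (leib r b gs)"
  by (induction gs) auto

lemma extV_leib_vgen:
  assumes "\<And>g. homog (gpar g + r) (b g)" "\<And>g. vpoly (b g)"
  shows "extV (leib r b) (vgen g) = b g"
  using extV_leib_mult[OF assms(1), of vone g] extV_prodl[OF swapsym_leib[OF assms(1)], of "[]"]
  by (simp add: assms)

section \<open>The derivation and the projection homomorphism\<close>

lemma homog_prodl: "homog (mpar (mset gs)) (prodl gs)"
  by (induction gs) (auto simp: homog_vone intro: homog_vmult homog_vgen)

lemma homog_leib:
  assumes "\<And>g. homog (gpar g + r) (b g)"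
  shows "homog (mpar (mset gs) + r) (leib r b gs)"
proof (induction gs)
  case (Cons g gs)
  have "homog (mpar (mset (g # gs)) + r) (vmult (vgen g) (leib r b gs))"
    using homog_vmult[OF homog_vgen Cons, of g] by (simp add: add.assoc)
  moreover have "homog (mpar (mset (g # gs)) + r) (vmult (b g) (prodl gs))"
    using homog_vmult[OF assms homog_prodl, of g gs] by (simp add: ac_simps)
  ultimately show ?case
    by (simp add: homog_vadd homog_vsmult)
qed simp

lemma homog_extV_leib:
  assumes "\<And>g. homog (gpar g + r) (b g)" "homog p P"
  shows "homog (p + r) (extV (leib r b) P)"
  unfolding extV_def
proof (rule homog_vsum, rule homog_vsmult)
  fix M assume "M \<in> supp P"
  then have "even (mpar M + p)"
    using assms(2) by (simp add: homog_def supp_def)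
  then show "homog (p + r) (leib r b (sorted_list_of_multiset M))"
    using homog_leib[OF assms(1), of "sorted_list_of_multiset M"] by (auto intro: homog_cong)
qed

lemma DV_extV: "DV P = extV (leib 1 (\<lambda>g. vgen (Dg g))) P"
proof -
  have "Dl gs = leib 1 (\<lambda>g. vgen (Dg g)) gs" for gs
    by (induction gs) (auto simp: vadd_commute)
  then show ?thesis
    by (simp add: DV_def extV_def)
qed

lemma homog_vgen_Dg: "homog (gpar g + 1) (vgen (Dg g))"
proof -
  have "gpar (Dg g) = gpar g + 1"
    by (cases g) (simp add: gpar_def Dg_def)
  then show ?thesis
    using homog_vgen[of "Dg g"] by simp
qed

lemma vpoly_DV [simp]: "vpoly (DV P)"
  by (simp add: DV_extV vpoly_extV leib_vpoly)

lemma DV_vgen: "DV (vgen g) = vgen (Dg g)"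
  unfolding DV_extV by (rule extV_leib_vgen) (simp_all only: homog_vgen_Dg vpoly_vgen)

lemma homog_DV: "homog p P \<Longrightarrow> homog (p + 1) (DV P)"
  unfolding DV_extV by (rule homog_extV_leib[OF homog_vgen_Dg])

lemma DV_vzero [simp]: "DV vzero = vzero"
  by (simp add: DV_extV)

lemma DV_vadd: "vpoly P \<Longrightarrow> vpoly Q \<Longrightarrow> DV (vadd P Q) = vadd (DV P) (DV Q)"
  by (simp add: DV_extV extV_vadd)

lemma DV_vsmult: "vpoly P \<Longrightarrow> DV (vsmult c P) = vsmult c (DV P)"
  by (simp add: DV_extV extV_vsmult)

lemma DV_vsum: "(\<And>a. a \<in> S \<Longrightarrow> vpoly (h a)) \<Longrightarrow> DV (vsum h S) = vsum (\<lambda>a. DV (h a)) S"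
  by (simp add: DV_extV extV_vsum)

text \<open>Only entries with indices in \<open>Iset n\<close> matter, since \<open>barD\<close> ignores the others.\<close>

definition mhom :: "nat \<Rightarrow> nat \<Rightarrow> mat \<Rightarrow> bool" where
  "mhom n q X \<longleftrightarrow> (\<forall>i\<in>Iset n. \<forall>j\<in>Iset n. X i j \<noteq> 0 \<longrightarrow> even (par i + par j + q))"

lemma vpoly_barD [simp]: "vpoly (barD n m X)"
  unfolding barD_def by (rule vpoly_vsum) auto

lemma homog_barD: "mhom n q X \<Longrightarrow> homog (q + 1 + m) (barD n m X)"
  unfolding barD_def
proof (rule homog_vsum, clarify)
  fix i j assume X: "mhom n q X" "i \<in> Iset n" "j \<in> Iset n"
  show "homog (q + 1 + m) (vsmult (X i j) (vgen (i, j, m)))"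
  proof (cases "X i j = 0")
    case False
    then have "even (par i + par j + q)"
      using X by (auto simp: mhom_def)
    then show ?thesis
      using homog_vgen[of "(i, j, m)"]
      by (auto simp: gpar_def intro!: homog_vsmult elim!: homog_cong)
  qed simp
qed

lemma DV_barD: "DV (barD n m X) = barD n (Suc m) X"
proof -
  have "DV (barD n m X) = vsum (\<lambda>p. DV (case p of (i, j) \<Rightarrow> vsmult (X i j) (vgen (i, j, m)))) (Iset n \<times> Iset n)"
    unfolding barD_def by (rule DV_vsum) auto
  also have "\<dots> = barD n (Suc m) X"
    unfolding barD_def by (rule vsum_cong) (auto simp: DV_vsmult DV_vgen Dg_def)
  finally show ?thesis .
qed

text \<open>The values of \<open>kappa\<close> on generators have the form
  \<open>barD n m X\<close>, so they must be admissible left factors. Homogeneity of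
  \<open>X\<close> makes the Leibniz signs of all contributing matrix units equal.\<close>

lemma extV_leib_barD:
  assumes b: "\<And>g. homog (gpar g + r) (b g)" and bp: "\<And>g. vpoly (b g)"
    and X: "mhom n q X" and Q: "vpoly Q"
  shows "extV (leib r b) (vmult (barD n m X) Q)
    = vadd (vsmult ((-1) ^ (r * (q + 1 + m))) (vmult (barD n m X) (extV (leib r b) Q)))
       (vmult (extV (leib r b) (barD n m X)) Q)"
proof -
  let ?I = "Iset n \<times> Iset n" and ?L = "extV (leib r b)"
  have "?L (vmult (barD n m X) Q) = vsum (\<lambda>p. ?L (vmult (case p of (i, j) \<Rightarrow> vsmult (X i j) (vgen (i, j, m))) Q)) ?I"
    unfolding barD_def vmult_vsum_left by (rule extV_vsum) (use Q in auto)
  also have "\<dots> = vsum (\<lambda>p. vadd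
      (vsmult ((-1) ^ (r * (q + 1 + m))) (vmult (case p of (i, j) \<Rightarrow> vsmult (X i j) (vgen (i, j, m))) (?L Q)))
      (vmult (?L (case p of (i, j) \<Rightarrow> vsmult (X i j) (vgen (i, j, m)))) Q)) ?I"
  proof (rule vsum_cong[OF refl], clarify)
    fix i j assume ij: "i \<in> Iset n" "j \<in> Iset n"
    show "?L (vmult (vsmult (X i j) (vgen (i, j, m))) Q) = vadd
      (vsmult ((-1) ^ (r * (q + 1 + m))) (vmult (vsmult (X i j) (vgen (i, j, m))) (?L Q)))
      (vmult (?L (vsmult (X i j) (vgen (i, j, m)))) Q)"
    proof (cases "X i j = 0")
      case False
      then have "even (par i + par j + q)"
        using X ij by (auto simp: mhom_def)
      then have "(-1::complex) ^ (r * gpar (i, j, m)) = (-1) ^ (r * (q + 1 + m))"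
        by (intro minus_one_power_cong) (auto simp: gpar_def)
      then show ?thesis
        using Q by (simp add: vmult_bilinear extV_vsmult extV_leib_mult[OF b] extV_leib_vgen[OF b bp] vsmult_vadd mult_ac)
    qed simp
  qed
  also have "\<dots> = vadd (vsmult ((-1) ^ (r * (q + 1 + m))) (vmult (barD n m X) (?L Q))) (vmult (?L (barD n m X)) Q)"
  proof -
    have "?L (barD n m X) = vsum (\<lambda>p. ?L (case p of (i, j) \<Rightarrow> vsmult (X i j) (vgen (i, j, m)))) ?I"
      unfolding barD_def by (rule extV_vsum) auto
    then show ?thesis
      unfolding barD_def vmult_vsum_left
      by (simp only: vmult_vsum_left) (simp add: v_defs sum.distrib sum_distrib_left)
  qed
  finally show ?thesis .
qed

lemma finite_Iset [simp]: "finite (Iset n)"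
  by (simp add: Iset_def)

lemma barD_vsum: "barD n m (\<lambda>k l. \<Sum>a\<in>S. c a * Y a k l) = vsum (\<lambda>a. vsmult (c a) (barD n m (Y a))) S"
proof (rule ext)
  fix M
  have "barD n m (\<lambda>k l. \<Sum>a\<in>S. c a * Y a k l) M =
     (\<Sum>(k, l)\<in>Iset n \<times> Iset n. \<Sum>a\<in>S. c a * (Y a k l * vgen (k, l, m) M))"
    by (simp add: barD_def v_defs case_prod_unfold sum_distrib_left sum_distrib_right mult_ac)
  also have "\<dots> = (\<Sum>a\<in>S. \<Sum>(k, l)\<in>Iset n \<times> Iset n. c a * (Y a k l * vgen (k, l, m) M))"
    unfolding case_prod_unfold by (rule sum.swap)
  also have "\<dots> = vsum (\<lambda>a. vsmult (c a) (barD n m (Y a))) S M"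
    by (simp add: barD_def v_defs case_prod_unfold sum_distrib_left)
  finally show "barD n m (\<lambda>k l. \<Sum>a\<in>S. c a * Y a k l) M = vsum (\<lambda>a. vsmult (c a) (barD n m (Y a))) S M" .
qed

lemma barD_cong: "(\<And>k l. k \<in> Iset n \<Longrightarrow> l \<in> Iset n \<Longrightarrow> X k l = Y k l) \<Longrightarrow> barD n m X = barD n m Y"
  unfolding barD_def by (rule vsum_cong) auto

lemma mat_expand:
  assumes "k \<in> Iset n" "l \<in> Iset n"
  shows "(\<Sum>p\<in>Iset n \<times> Iset n. X (fst p) (snd p) * E (fst p) (snd p) k l) = X k l"
proof -
  have "(\<Sum>p\<in>Iset n \<times> Iset n. X (fst p) (snd p) * E (fst p) (snd p) k l)
      = (\<Sum>p\<in>Iset n \<times> Iset n. if p = (k, l) then X k l else 0)"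
    by (rule sum.cong) (auto simp: E_def)
  then show ?thesis
    using assms by simp
qed

section \<open>The projection onto the fixed part of theta, and \<open>kappa\<close> as a
  differential homomorphism\<close>

definition proj :: "nat \<Rightarrow> mat \<Rightarrow> mat" where
  "proj n X = (\<lambda>k l. (1/2) * (X k l + theta n X k l))"

lemma kgen_proj: "kgen n (i, j, m) = barD n m (proj n (E i j))"
  by (simp add: kgen_def proj_def)

lemma prm_Iset [simp]: "k \<in> Iset n \<Longrightarrow> prm n k \<in> Iset n"
  by (auto simp: Iset_def prm_def)

lemma prm_prm [simp]: "k \<in> Iset n \<Longrightarrow> prm n (prm n k) = k"
  by (auto simp: Iset_def prm_def)

lemma even_par: "even (par i) \<longleftrightarrow> odd i"
  by (simp add: par_def)

lemma par_prm [simp]: "k \<in> Iset n \<Longrightarrow> par (prm n k) = par k"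
  by (auto simp: Iset_def prm_def par_def)

lemma mhom_theta: "mhom n q X \<Longrightarrow> mhom n q (theta n X)"
  unfolding mhom_def
proof (intro ballI impI)
  fix i j assume X: "\<forall>i\<in>Iset n. \<forall>j\<in>Iset n. X i j \<noteq> 0 \<longrightarrow> even (par i + par j + q)"
    and ij: "i \<in> Iset n" "j \<in> Iset n" and "theta n X i j \<noteq> 0"
  then have "X (prm n j) (prm n i) \<noteq> 0"
    by (auto simp: theta_def)
  then have "even (par (prm n j) + par (prm n i) + q)"
    using X ij prm_Iset by blast
  then show "even (par i + par j + q)"
    using ij by (auto simp: even_par)
qed

lemma mhom_proj: "mhom n q X \<Longrightarrow> mhom n q (proj n X)"
  using mhom_theta[of n q X] unfolding mhom_def proj_def by fastforce

lemma mhom_E: "mhom n (par i + par j) (E i j)"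
  by (auto simp: mhom_def E_def)

lemma homog_kgen: "homog (gpar g) (kgen n g)"
proof (cases g)
  case (fields i j m)
  then show ?thesis
    using homog_barD[OF mhom_proj[OF mhom_E], of i j m n]
    by (simp add: kgen_proj gpar_def)
qed

lemma vpoly_kgen [simp]: "vpoly (kgen n g)"
  by (cases g) (simp add: kgen_proj)

lemma vpoly_kl [simp]: "vpoly (kl n gs)"
  by (induction gs) auto

lemma kappa_extV: "kappa n w = extV (kl n) w"
  by (simp add: kappa_def extV_def)

lemma vpoly_kappa [simp]: "vpoly (kappa n w)"
  by (simp add: kappa_extV vpoly_extV)

text \<open>The image \<open>kgen n g\<close> has the parity of \<open>g\<close>, so words of images
  obey the Koszul rule and \<open>kappa\<close> may be evaluated on unsorted words.\<close>

lemma kappa_prodl: "kappa n (prodl gs) = kl n gs"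
  unfolding kappa_extV
  by (rule extV_prodl, rule swapsym_mult[where a = "kgen n"]) (auto simp only: kl.simps homog_kgen)

lemma kappa_vone [simp]: "kappa n vone = vone"
  using kappa_prodl[of n "[]"] by simp

lemma kappa_vzero [simp]: "kappa n vzero = vzero"
  by (simp add: kappa_extV)

lemma kappa_vgen: "kappa n (vgen g) = kgen n g"
  using kappa_prodl[of n "[g]"] by simp

lemma kappa_vadd: "vpoly P \<Longrightarrow> vpoly Q \<Longrightarrow> kappa n (vadd P Q) = vadd (kappa n P) (kappa n Q)"
  by (simp add: kappa_extV extV_vadd)

lemma kappa_vsmult: "vpoly P \<Longrightarrow> kappa n (vsmult c P) = vsmult c (kappa n P)"
  by (simp add: kappa_extV extV_vsmult)

lemma kappa_vmult:
  assumes "vpoly P" "vpoly Q"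
  shows "kappa n (vmult P Q) = vmult (kappa n P) (kappa n Q)"
proof -
  have gen: "kappa n (vmult (vgen g) Q) = vmult (kgen n g) (kappa n Q)" if "vpoly Q" for g Q
    using that
  proof (induction rule: vpoly_induct)
    case (prodl gs)
    show ?case
      using kappa_prodl[of n "g # gs"] by (simp add: kappa_prodl)
  qed (auto simp: vmult_bilinear kappa_vadd kappa_vsmult)
  have list: "kappa n (vmult (prodl gs) Q) = vmult (kl n gs) (kappa n Q)" for gs
    by (induction gs) (auto simp: vmult_assoc gen assms)
  from assms(1) show ?thesis
    by (induction rule: vpoly_induct) (auto simp: list kappa_prodl vmult_bilinear kappa_vadd kappa_vsmult assms)
qed

lemma kappa_barD: "kappa n (barD n m X) = barD n m (proj n X)"
proof -
  let ?I = "Iset n \<times> Iset n"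
  have "kappa n (barD n m X) = vsum (\<lambda>p. kappa n (case p of (i, j) \<Rightarrow> vsmult (X i j) (vgen (i, j, m)))) ?I"
    unfolding barD_def kappa_extV by (rule extV_vsum) auto
  also have "\<dots> = vsum (\<lambda>p. vsmult (X (fst p) (snd p)) (barD n m (proj n (E (fst p) (snd p))))) ?I"
    by (rule vsum_cong) (auto simp: kappa_vsmult kappa_vgen kgen_proj)
  also have "\<dots> = barD n m (\<lambda>k l. \<Sum>p\<in>?I. X (fst p) (snd p) * proj n (E (fst p) (snd p)) k l)"
    by (rule barD_vsum[symmetric])
  also have "\<dots> = barD n m (proj n X)"
  proof (rule barD_cong)
    fix k l assume kl: "k \<in> Iset n" "l \<in> Iset n"
    let ?s = "tsign n (prm n l) (prm n k)"
    \<comment> \<open>The theta half of the projection reads the matrix units at the entry (l', k'),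
      so the expansion in matrix units is used at two different entries.\<close>
    have "(\<Sum>p\<in>?I. X (fst p) (snd p) * proj n (E (fst p) (snd p)) k l)
      = (1/2) * ((\<Sum>p\<in>?I. X (fst p) (snd p) * E (fst p) (snd p) k l)
        + ?s * (\<Sum>p\<in>?I. X (fst p) (snd p) * E (fst p) (snd p) (prm n l) (prm n k)))"
      using kl by (simp add: proj_def theta_def sum.distrib[symmetric] sum_distrib_left algebra_simps)
    also have "\<dots> = proj n X k l"
      unfolding mat_expand[OF kl] mat_expand[OF prm_Iset[OF kl(2)] prm_Iset[OF kl(1)]]
      using kl by (simp add: proj_def theta_def)
    finally show "(\<Sum>p\<in>?I. X (fst p) (snd p) * proj n (E (fst p) (snd p)) k l) = proj n X k l" .
  qed
  finally show ?thesis .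
qed

lemma DV_vmult_barD:
  assumes "mhom n q X" "vpoly Q"
  shows "DV (vmult (barD n m X) Q)
    = vadd (vsmult ((-1) ^ (q + 1 + m)) (vmult (barD n m X) (DV Q))) (vmult (barD n (Suc m) X) Q)"
  using extV_leib_barD[OF homog_vgen_Dg vpoly_vgen assms, of m]
  unfolding DV_extV[symmetric] DV_barD by simp

text \<open>On generators the derivation only raises the index \<open>m\<close>, which the
  projection leaves alone; the Leibniz signs agree because \<open>kgen n g\<close> has the parity of
  \<open>g\<close>.\<close>

lemma kappa_DV:
  assumes "vpoly P"
  shows "kappa n (DV P) = DV (kappa n P)"
  using assms
proof (induction rule: vpoly_induct)
  case (prodl gs)
  show ?case
  proof (induction gs)
    case Nil
    have "DV vone = vzero"
      using extV_prodl[OF swapsym_leib[OF homog_vgen_Dg], of "[]"] by (simp add: DV_extV)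
    then show ?case
      by simp
  next
    case (Cons g gs)
    obtain i j m where g: "g = (i, j, m)"
      by (cases g)
    have "DV (prodl (g # gs)) = vadd (vsmult ((-1) ^ gpar g) (vmult (vgen g) (DV (prodl gs))))
        (vmult (vgen (Dg g)) (prodl gs))"
      using extV_leib_mult[OF homog_vgen_Dg vpoly_prodl, of g gs] by (simp add: DV_extV)
    then have "kappa n (DV (prodl (g # gs))) = vadd (vsmult ((-1) ^ gpar g) (vmult (kgen n g) (DV (kl n gs))))
        (vmult (kgen n (Dg g)) (kl n gs))"
      using Cons by (simp add: kappa_vadd kappa_vsmult kappa_vmult kappa_vgen kappa_prodl)
    also have "\<dots> = DV (vmult (kgen n g) (kl n gs))"
      using DV_vmult_barD[of n "par i + par j" "proj n (E i j)" "kl n gs" m, OF mhom_proj[OF mhom_E] vpoly_kl]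
      by (simp add: g kgen_proj gpar_def Dg_def)
    finally show ?case
      by (simp add: kappa_prodl kappa_vmult kappa_vgen)
  qed
qed (auto simp: kappa_vadd kappa_vsmult DV_vadd DV_vsmult)

section \<open>The involution theta on matrices\<close>

lemma theta_in_gl [simp]: "theta n X \<in> gl n"
  by (auto simp: gl_def theta_def split: if_splits)

text \<open>Priming is the reflection about 2n+1. For even \<open>k\<close> exactly one of k and k'
  lies in the range where \<open>dlt\<close> is 1; for odd \<open>k\<close> neither does.\<close>

lemma dlt_prm: "k \<in> Iset n \<Longrightarrow> even (dlt n k + dlt n (prm n k) + par k)"
proof (cases "even k")
  case True
  moreover assume "k \<in> Iset n"
  ultimately obtain r where "k = 2 * r" "1 \<le> r" "r \<le> 2 * n"
    by (auto simp: Iset_def elim!: evenE)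
  then show ?thesis
    by (auto simp: prm_def dlt_def par_def; presburger)
qed (auto simp: Iset_def prm_def dlt_def par_def)

text \<open>Exchanging the indices replaces the summand \<open>par l\<close> of the exponent by
  \<open>par k\<close>, and priming the deltas adds \<open>par k + par l\<close> modulo 2; the two
  changes cancel. This is what makes theta an involution.\<close>

lemma tsign_prm:
  assumes "k \<in> Iset n" "l \<in> Iset n"
  shows "tsign n (prm n l) (prm n k) = tsign n k l"
proof -
  have "even (dlt n k + dlt n (prm n k) + par k)" "even (dlt n l + dlt n (prm n l) + par l)"
    using dlt_prm assms by auto
  then show ?thesis
    unfolding tsign_def using assms by (intro minus_one_power_cong) (auto simp: even_par)
qed

lemma tsign_square [simp]: "tsign n k l * tsign n k l = 1"
  by (simp add: tsign_def flip: power_add)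

lemma theta_theta:
  assumes "X \<in> gl n"
  shows "theta n (theta n X) = X"
proof (intro ext)
  fix k l
  show "theta n (theta n X) k l = X k l"
  proof (cases "k \<in> Iset n \<and> l \<in> Iset n")
    case True
    then show ?thesis
      by (simp add: theta_def tsign_prm flip: mult.assoc)
  next
    case False
    then show ?thesis
      using assms by (auto simp: theta_def gl_def)
  qed
qed

lemma proj_osp:
  assumes "X \<in> gl n"
  shows "proj n X \<in> osp n"
proof -
  have "proj n X \<in> gl n"
    using assms theta_in_gl[of n X] by (auto simp: gl_def proj_def) (metis add.right_neutral)+
  moreover have "theta n (proj n X) k l = (1/2) * (theta n X k l + theta n (theta n X) k l)" for k l
    by (simp add: theta_def proj_def algebra_simps)
  ultimately show ?thesis
    using theta_theta[OF assms] by (auto simp: osp_def proj_def fun_eq_iff)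
qed

text \<open>theta moves the entry (l', k') to (k, l), and k' - l' = l - k, so the grading is
  preserved. The difference is taken in the integers to avoid truncation, and a general
  \<open>R\<close> serves both halves of the grading.\<close>

lemma theta_triangular:
  assumes "\<And>i j. X i j \<noteq> 0 \<Longrightarrow> R (int j - int i)" "theta n X k l \<noteq> 0"
  shows "R (int l - int k)"
proof -
  have kl: "k \<in> Iset n" "l \<in> Iset n" "X (prm n l) (prm n k) \<noteq> 0"
    using assms(2) by (auto simp: theta_def split: if_splits)
  then have "int (prm n k) - int (prm n l) = int l - int k"
    by (auto simp: Iset_def prm_def of_nat_diff)
  then show ?thesis
    using assms(1)[OF kl(3)] by simp
qed

lemma proj_posPart:
  assumes "X \<in> posPart n (gl n)"
  shows "proj n X \<in> posPart n (osp n)"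
proof -
  have "k < l" if "proj n X k l \<noteq> 0" for k l
    using that assms theta_triangular[of X "\<lambda>d. 0 < d" n k l]
    by (cases "X k l = 0") (auto simp: proj_def posPart_def)
  then show ?thesis
    using assms proj_osp by (auto simp: posPart_def)
qed

lemma proj_nonposPart:
  assumes "X \<in> nonposPart n (gl n)"
  shows "proj n X \<in> nonposPart n (osp n)"
proof -
  have "l \<le> k" if "proj n X k l \<noteq> 0" for k l
    using that assms theta_triangular[of X "\<lambda>d. d \<le> 0" n k l]
    by (cases "X k l = 0") (auto simp: proj_def nonposPart_def)
  then show ?thesis
    using assms proj_osp by (auto simp: nonposPart_def)
qed

section \<open>Invariance of the form and of the bracket under theta\<close>

lemma sum_prm: "(\<Sum>c\<in>Iset n. h (prm n c)) = (\<Sum>c\<in>Iset n. h c)"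
  by (rule sum.reindex_bij_witness[where i = "prm n" and j = "prm n"]) auto

lemma osp_entry:
  assumes "X \<in> osp n" "k \<in> Iset n" "l \<in> Iset n"
  shows "X (prm n l) (prm n k) = tsign n k l * X k l"
proof -
  have "X k l = tsign n k l * X (prm n l) (prm n k)"
    using assms by (subst (1) assms(1)[unfolded osp_def, simplified, THEN conjunct2, symmetric])
      (simp add: theta_def tsign_prm)
  then show ?thesis
    by (simp flip: mult.assoc)
qed

text \<open>As \<open>X\<close> is fixed, its entries can be primed along with those of
  \<open>Y\<close> at the cost of signs; reindexing by primes and exchanging the two sums then
  restores the form.\<close>

lemma strf_theta:
  assumes "X \<in> osp n"
  shows "strf n X (theta n Y) = strf n X Y"
proof -
  have "strf n X (theta n Y) = (\<Sum>i\<in>Iset n. \<Sum>j\<in>Iset n. (-1) ^ par i * (X i j * theta n Y j i))"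
    by (simp add: strf_def sum_distrib_left)
  also have "\<dots> = (\<Sum>i\<in>Iset n. \<Sum>j\<in>Iset n. (-1) ^ par (prm n j) * (X (prm n j) (prm n i) * Y (prm n i) (prm n j)))"
  proof (intro sum.cong refl)
    fix i j assume ij: "i \<in> Iset n" "j \<in> Iset n"
    \<comment> \<open>Every delta and the product of the parities occur twice, so the two
      \<open>tsign\<close> exponents together contribute \<open>par i + par j\<close>: just what
      turns the supertrace sign of \<open>i\<close> into that of \<open>j\<close>.\<close>
    have "even (par i + (par i * par j + par j + 1 + dlt n i + dlt n j + (par j * par i + par i + 1 + dlt n j + dlt n i)) + par j)"
      by auto
    then have "(-1::complex) ^ par i * (tsign n i j * tsign n j i) = (-1) ^ par j"
      unfolding tsign_def power_add[symmetric] by (rule minus_one_power_cong)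
    moreover have "a * t = b * s" if "a * (s * t) = b" "s * s = 1" for a b s t :: complex
    proof -
      have "b * s = a * t * (s * s)"
        by (simp only: that(1)[symmetric] mult_ac)
      then show ?thesis
        using that(2) by simp
    qed
    ultimately have e: "(-1) ^ par i * tsign n j i = (-1) ^ par j * tsign n i j"
      using tsign_square by blast
    then show "(-1) ^ par i * (X i j * theta n Y j i)
      = (-1) ^ par (prm n j) * (X (prm n j) (prm n i) * Y (prm n i) (prm n j))"
      using ij arg_cong[OF e, of "\<lambda>z. z * (X i j * Y (prm n i) (prm n j))"]
      by (simp add: osp_entry[OF assms] theta_def tsign_prm mult_ac)
  qed
  also have "\<dots> = (\<Sum>j\<in>Iset n. \<Sum>i\<in>Iset n. (-1) ^ par (prm n j) * (X (prm n j) (prm n i) * Y (prm n i) (prm n j)))"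
    by (rule sum.swap)
  also have "\<dots> = (\<Sum>j\<in>Iset n. \<Sum>i\<in>Iset n. (-1) ^ par j * (X j i * Y i j))"
    using sum_prm[of "\<lambda>j. \<Sum>i\<in>Iset n. (-1) ^ par j * (X j (prm n i) * Y (prm n i) j)" n]
      sum_prm[of "\<lambda>i. (-1) ^ par j * (X j i * Y i j)" n for j] by simp
  finally show ?thesis
    by (simp add: strf_def sum_distrib_left)
qed

lemma strf_proj: "X \<in> osp n \<Longrightarrow> strf n X (proj n Y) = strf n X Y"
proof -
  assume "X \<in> osp n"
  then have "strf n X Y = (strf n X Y + strf n X (theta n Y)) / 2"
    by (simp add: strf_theta)
  also have "\<dots> = strf n X (proj n Y)"
    by (simp add: strf_def proj_def sum_distrib_left sum_divide_distrib sum.distrib[symmetric] algebra_simps add_divide_distrib)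
  finally show ?thesis ..
qed

text \<open>A matrix does not carry its parity, so \<open>p\<close> and \<open>q\<close> are
  parameters. For arguments satisfying \<open>mhom\<close> with these values this is the
  supercommutator.\<close>

definition sbr :: "nat \<Rightarrow> nat \<Rightarrow> nat \<Rightarrow> mat \<Rightarrow> mat \<Rightarrow> mat" where
  "sbr n p q X Y = (\<lambda>a b. (\<Sum>c\<in>Iset n. X a c * Y c b) - (-1) ^ (p * q) * (\<Sum>c\<in>Iset n. Y a c * X c b))"

text \<open>The deltas cancel in pairs, and \<open>par c\<close> agrees with its square modulo 2,
  which leaves the exponent 1 + (p(k) + p(c))(p(c) + p(l)). Thus theta reverses products with the
  sign -(-1)^(pq), like minus a supertransposition, and hence preserves supercommutators.\<close>

lemma tsign_cocycle:
  assumes "even (par k + par c + p)" "even (par c + par l + q)"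
  shows "tsign n k l * (tsign n k c * tsign n c l) = - ((-1) ^ (p * q))"
proof -
  have "tsign n k l * (tsign n k c * tsign n c l) = (-1) ^ (1 + p * q)"
    unfolding tsign_def power_add[symmetric]
    by (rule minus_one_power_cong) (use assms in auto)
  then show ?thesis
    by simp
qed

lemma theta_sbr:
  assumes X: "X \<in> osp n" "mhom n p X" and Y: "mhom n q Y" and kl: "k \<in> Iset n" "l \<in> Iset n"
  shows "theta n (sbr n p q X Y) k l = sbr n p q X (theta n Y) k l"
proof -
  note tY = mhom_theta[OF Y]
  have *: "Y (prm n b) (prm n a) = tsign n a b * theta n Y a b" if "a \<in> Iset n" "b \<in> Iset n" for a b
    using that by (simp add: theta_def tsign_prm flip: mult.assoc)
  have 1: "tsign n k l * (X (prm n l) (prm n c) * Y (prm n c) (prm n k))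
      = - ((-1) ^ (p * q)) * (theta n Y k c * X c l)" if c: "c \<in> Iset n" for c
  \<comment> \<open>Homogeneity determines the parity of an index pair only where the entry is
    nonzero; elsewhere both sides vanish.\<close>
  proof (cases "theta n Y k c = 0 \<or> X c l = 0")
    case True
    then show ?thesis
      using c kl by (auto simp: * osp_entry[OF X(1)])
  next
    case False
    then have "even (par k + par c + q)" "even (par c + par l + p)"
      using tY X(2) c kl by (auto simp: mhom_def)
    from tsign_cocycle[OF this, of n] show ?thesis
      using c kl by (simp add: * osp_entry[OF X(1)] mult_ac) (simp add: flip: mult.assoc)
  qed
  have 2: "tsign n k l * (Y (prm n l) (prm n c) * X (prm n c) (prm n k))
      = - ((-1) ^ (p * q)) * (X k c * theta n Y c l)" if c: "c \<in> Iset n" for c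
  proof (cases "theta n Y c l = 0 \<or> X k c = 0")
    case True
    then show ?thesis
      using c kl by (auto simp: * osp_entry[OF X(1)])
  next
    case False
    then have "even (par k + par c + p)" "even (par c + par l + q)"
      using tY X(2) c kl by (auto simp: mhom_def)
    from tsign_cocycle[OF this, of n] show ?thesis
      using c kl by (simp add: * osp_entry[OF X(1)] mult_ac) (simp add: flip: mult.assoc)
  qed
  have "theta n (sbr n p q X Y) k l = tsign n k l * sbr n p q X Y (prm n l) (prm n k)"
    using kl by (simp add: theta_def tsign_prm)
  \<comment> \<open>The summation index is primed as well, so that each product has the shape
    treated in \<open>1\<close> and \<open>2\<close>.\<close>
  also have "\<dots> = (\<Sum>c\<in>Iset n. tsign n k l * (X (prm n l) (prm n c) * Y (prm n c) (prm n k)))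
      - (-1) ^ (p * q) * (\<Sum>c\<in>Iset n. tsign n k l * (Y (prm n l) (prm n c) * X (prm n c) (prm n k)))"
    unfolding sbr_def sum_prm[of "\<lambda>c. X (prm n l) c * Y c (prm n k)", symmetric]
      sum_prm[of "\<lambda>c. Y (prm n l) c * X c (prm n k)", symmetric]
    by (simp add: sum_distrib_left right_diff_distrib mult_ac)
  also have "\<dots> = sbr n p q X (theta n Y) k l"
  proof -
    have "(\<Sum>c\<in>Iset n. tsign n k l * (X (prm n l) (prm n c) * Y (prm n c) (prm n k)))
        = - ((-1) ^ (p * q)) * (\<Sum>c\<in>Iset n. theta n Y k c * X c l)"
      unfolding sum_distrib_left by (intro sum.cong 1 refl)
    moreover have "(\<Sum>c\<in>Iset n. tsign n k l * (Y (prm n l) (prm n c) * X (prm n c) (prm n k)))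
        = - ((-1) ^ (p * q)) * (\<Sum>c\<in>Iset n. X k c * theta n Y c l)"
      unfolding sum_distrib_left by (intro sum.cong 2 refl)
    ultimately show ?thesis
      by (simp add: sbr_def flip: mult.assoc power_add)
  qed
  finally show ?thesis .
qed

lemma proj_sbr:
  assumes "X \<in> osp n" "mhom n p X" "mhom n q Y" "k \<in> Iset n" "l \<in> Iset n"
  shows "proj n (sbr n p q X Y) k l = sbr n p q X (proj n Y) k l"
  unfolding proj_def theta_sbr[OF assms]
  by (simp add: sbr_def sum_distrib_left sum.distrib algebra_simps)

section \<open>The bracket as a derivation\<close>

text \<open>Since chi is odd, the coefficients of a homogeneous element have alternating parity; D +
  chi is odd and shifts all of them by one.\<close>

lemma homog_Dchi:
  assumes "\<And>d. homog (r + d) (u d)"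
  shows "homog (r + d + 1) (Dchi u d)"
proof (cases d)
  case 0
  then show ?thesis
    using homog_DV[OF assms, of 0] by (simp add: Dchi_def)
next
  case (Suc e)
  have "homog (r + d + 1) (u e)"
    using assms[of e] by (rule homog_cong) (simp add: Suc)
  then show ?thesis
    using homog_DV[OF assms, of d] by (auto simp: Dchi_def Suc intro!: homog_vadd homog_vsmult)
qed

lemma vpoly_Dchi [simp]: "(\<And>d. vpoly (u d)) \<Longrightarrow> vpoly (Dchi u d)"
  by (simp add: Dchi_def)

lemma brg_0: "brg n a (k, l, 0) = br0 n a (k, l)"
  by (cases a) (simp add: brg_def)

lemma brg_Suc: "brg n (i, j) (k, l, Suc m) = csmult ((-1) ^ (par i + par j)) (Dchi (brg n (i, j) (k, l, m)))"
  by (simp add: brg_def)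

lemma vpoly_brg [simp]: "vpoly (brg n a g d)"
proof (cases a, cases g)
  fix i j k l m assume "a = (i, j)" "g = (k, l, m)"
  moreover have "vpoly (brg n (i, j) (k, l, m) d)" for d
    by (induction m arbitrary: d) (auto simp: brg_0 brg_Suc br0_def csmult_def)
  ultimately show ?thesis
    by simp
qed

lemma strf_E:
  "strf n (E i j) (E k l) = (if i \<in> Iset n \<and> j \<in> Iset n \<and> j = k \<and> i = l then (-1) ^ par i else 0)"
proof -
  have "strf n (E i j) (E k l) = (\<Sum>x\<in>Iset n. if x = i then (\<Sum>y\<in>Iset n. if y = j then
      (if j = k \<and> i = l then (-1) ^ par i else 0) else 0) else 0)"
  proof -
    have "(-1) ^ par x * (E i j x y * E k l y x)
        = (if x = i then if y = j then if j = k \<and> i = l then (-1) ^ par i else 0 else 0 else 0)" for x y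
      by (simp add: E_def)
    then show ?thesis
      unfolding strf_def sum_distrib_left by (intro sum.cong refl) simp
  qed
  then show ?thesis
    by auto
qed

lemma mhom_brE: "mhom n (par i + par j + (par k + par l)) (brE i j k l)"
  by (auto simp: mhom_def brE_def E_def split: if_splits)

lemma homog_brg: "homog (gpar g + (par i + par j + d)) (brg n (i, j) g d)"
proof (cases g)
  case (fields k l m)
  have "homog (gpar (k, l, m) + (par i + par j) + d) (brg n (i, j) (k, l, m) d)"
  proof (induction m arbitrary: d)
    case 0
    have "homog (par k + par l + 1 + (par i + par j)) (barV n (brE i j k l))"
      using homog_barD[OF mhom_brE] by (rule homog_cong) auto
    moreover have "homog (par k + par l + 1 + (par i + par j) + 1) (vsmult (strf n (E i j) (E k l)) vone)"
    proof (cases "strf n (E i j) (E k l) = 0")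
      case False
      \<comment> \<open>The form pairs e_ij only with e_ji, which has the same parity, so the scalar
        at chi^1 has the required even parity.\<close>
      then have "j = k" "i = l"
        by (auto simp: strf_E split: if_splits)
      then show ?thesis
        using homog_vone by (auto intro!: homog_vsmult elim!: homog_cong)
    qed simp
    ultimately show ?case
      by (auto simp: brg_0 br0_def gpar_def intro: homog_vsmult)
  next
    case (Suc m)
    have "homog (gpar (k, l, m) + (par i + par j) + d + 1) (Dchi (brg n (i, j) (k, l, m)) d)"
      by (rule homog_Dchi) (rule Suc.IH)
    then show ?case
      by (auto simp: brg_Suc csmult_def gpar_def intro!: homog_vsmult elim!: homog_cong)
  qed
  then show ?thesis
    by (simp add: fields add_ac)
qed

section \<open>Leibniz rule and sesquilinearity in the second argument\<close>

abbreviation ebr :: "nat \<Rightarrow> nat \<times> nat \<Rightarrow> nat \<Rightarrow> V \<Rightarrow> V" where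
  "ebr n a d \<equiv> extV (leib (par (fst a) + par (snd a) + d) (\<lambda>g. brg n a g d))"

text \<open>Moving chi^d past \<open>vgen g\<close> in \<open>lmul\<close> contributes
  \<open>(-1) ^ (gpar g * d)\<close>; together with the Leibniz sign of \<open>brl\<close> this is
  the sign of a derivation of parity p(a) + d.\<close>

lemma brl_leib: "brl n a gs d = leib (par (fst a) + par (snd a) + d) (\<lambda>g. brg n a g d) gs"
proof (induction gs)
  case (Cons g gs)
  then show ?case
    by (simp add: cadd_def csmult_def lmul_def rmul_def power_add[symmetric] algebra_simps)
qed (simp add: czero_def)

lemma LBr_ebr: "LBr n X w d = vsum (\<lambda>a. vsmult (X (fst a) (snd a)) (ebr n a d w)) (Iset n \<times> Iset n)"
  unfolding LBr_def extV_def by (rule vsum_cong) (auto simp: brl_leib)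

lemma homog_brg_pair: "homog (gpar g + (par (fst a) + par (snd a) + d)) (brg n a g d)"
  using homog_brg[of g "fst a" "snd a" d n] by simp

lemma ebr_vgen: "ebr n a d (vgen g) = brg n a g d"
  by (rule extV_leib_vgen) (auto simp only: homog_brg_pair vpoly_brg)

lemma vpoly_ebr [simp]: "vpoly (ebr n a d w)"
  by (rule vpoly_extV) (simp add: leib_vpoly)

lemma vpoly_LBr [simp]: "vpoly (LBr n X w d)"
  by (simp add: LBr_ebr)

lemma vsum_vadd: "vsum (\<lambda>a. vadd (h a) (k a)) S = vadd (vsum h S) (vsum k S)"
  by (simp add: v_defs sum.distrib)

lemma vsum_vsmult: "vsum (\<lambda>a. vsmult c (h a)) S = vsmult c (vsum h S)"
  by (simp add: v_defs sum_distrib_left)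

lemma LBr_vzero [simp]: "LBr n X vzero d = vzero"
  by (simp add: LBr_ebr)

lemma LBr_vadd: "vpoly P \<Longrightarrow> vpoly Q \<Longrightarrow> LBr n X (vadd P Q) d = vadd (LBr n X P d) (LBr n X Q d)"
  by (simp add: LBr_ebr extV_vadd vsmult_vadd vsum_vadd)

lemma LBr_vsmult: "vpoly P \<Longrightarrow> LBr n X (vsmult c P) d = vsmult c (LBr n X P d)"
  by (simp add: LBr_ebr extV_vsmult vsum_vsmult[symmetric] mult.commute)

lemma LBr_vsum: "(\<And>a. a \<in> S \<Longrightarrow> vpoly (h a)) \<Longrightarrow> LBr n X (vsum h S) d = vsum (\<lambda>a. LBr n X (h a) d) S"
proof (cases "finite S")
  case True
  then show "(\<And>a. a \<in> S \<Longrightarrow> vpoly (h a)) \<Longrightarrow> LBr n X (vsum h S) d = vsum (\<lambda>a. LBr n X (h a) d) S"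
    by (induction S) (auto simp: LBr_vadd)
qed (simp add: vsum_infinite)

lemma LBr_add_left: "LBr n (\<lambda>i j. X i j + Y i j) w d = vadd (LBr n X w d) (LBr n Y w d)"
  by (simp add: LBr_ebr v_defs sum.distrib algebra_simps)

lemma LBr_vone [simp]: "LBr n X vone d = vzero"
proof -
  have "ebr n a d vone = vzero" for a
    using extV_prodl[OF swapsym_leib[of "par (fst a) + par (snd a) + d" "\<lambda>g. brg n a g d", OF homog_brg_pair], of "[]"]
    by simp
  then show ?thesis
    by (simp add: LBr_ebr)
qed

text \<open>The rule for single matrix units carries a sign depending on the unit; homogeneity of
  \<open>X\<close> replaces it by one common sign. Generators and \<open>barD\<close> elements as
  left factors both use this argument.\<close>

lemma LBr_vmult_aux:
  assumes X: "mhom n p X"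
    and L: "\<And>a. ebr n a d (vmult P Q) = vadd (vsmult ((-1) ^ ((par (fst a) + par (snd a) + d) * q)) (vmult P (ebr n a d Q)))
       (vmult (ebr n a d P) Q)"
  shows "LBr n X (vmult P Q) d = vadd (vsmult ((-1) ^ ((p + d) * q)) (vmult P (LBr n X Q d)))
    (vmult (LBr n X P d) Q)"
proof -
  have "LBr n X (vmult P Q) d = vsum (\<lambda>a. vadd
      (vsmult ((-1) ^ ((p + d) * q)) (vmult P (vsmult (X (fst a) (snd a)) (ebr n a d Q))))
      (vmult (vsmult (X (fst a) (snd a)) (ebr n a d P)) Q)) (Iset n \<times> Iset n)"
    unfolding LBr_ebr
  proof (rule vsum_cong[OF refl])
    fix a assume a: "a \<in> Iset n \<times> Iset n"
    show "vsmult (X (fst a) (snd a)) (ebr n a d (vmult P Q)) = vadd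
      (vsmult ((-1) ^ ((p + d) * q)) (vmult P (vsmult (X (fst a) (snd a)) (ebr n a d Q))))
      (vmult (vsmult (X (fst a) (snd a)) (ebr n a d P)) Q)"
    proof (cases "X (fst a) (snd a) = 0")
      case False
      then have "even (par (fst a) + par (snd a) + p)"
        using a X by (auto simp: mhom_def)
      then have "(-1::complex) ^ ((par (fst a) + par (snd a) + d) * q) = (-1) ^ ((p + d) * q)"
        by (intro minus_one_power_cong) auto
      then show ?thesis
        by (simp add: L vmult_bilinear vsmult_vadd mult_ac)
    qed simp
  qed
  then show ?thesis
    by (simp add: vsum_vadd vsum_vsmult LBr_ebr vmult_vsum_left vmult_vsum_right)
qed

lemma LBr_vmult_vgen:
  assumes "mhom n p X" "vpoly Q"
  shows "LBr n X (vmult (vgen g) Q) d = vadd (vsmult ((-1) ^ ((p + d) * gpar g)) (vmult (vgen g) (LBr n X Q d)))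
    (vmult (LBr n X (vgen g) d) Q)"
  by (rule LBr_vmult_aux[OF assms(1)])
    (simp only: extV_leib_mult[OF homog_brg_pair assms(2)] ebr_vgen)

lemma LBr_vmult_barD:
  assumes "mhom n p X" "mhom n q Y" "vpoly Q"
  shows "LBr n X (vmult (barD n m Y) Q) d
    = vadd (vsmult ((-1) ^ ((p + d) * (q + 1 + m))) (vmult (barD n m Y) (LBr n X Q d)))
       (vmult (LBr n X (barD n m Y) d) Q)"
  by (rule LBr_vmult_aux[OF assms(1)]) (rule extV_leib_barD[OF homog_brg_pair vpoly_brg assms(2,3)])

lemma LBr_vgen: "LBr n X (vgen g) d = vsum (\<lambda>a. vsmult (X (fst a) (snd a)) (brg n a g d)) (Iset n \<times> Iset n)"
  by (simp add: LBr_ebr ebr_vgen)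

lemma LBr_barD: "LBr n X (barD n m Y) d
  = vsum (\<lambda>b. vsmult (Y (fst b) (snd b)) (LBr n X (vgen (fst b, snd b, m)) d)) (Iset n \<times> Iset n)"
proof -
  have "LBr n X (barD n m Y) d = vsum (\<lambda>b. LBr n X (case b of (k, l) \<Rightarrow> vsmult (Y k l) (vgen (k, l, m))) d) (Iset n \<times> Iset n)"
    unfolding barD_def by (rule LBr_vsum) auto
  also have "\<dots> = vsum (\<lambda>b. vsmult (Y (fst b) (snd b)) (LBr n X (vgen (fst b, snd b, m)) d)) (Iset n \<times> Iset n)"
    by (rule vsum_cong) (auto simp: LBr_vsmult)
  finally show ?thesis .
qed

lemma Dchi_vsum:
  assumes "\<And>a d. a \<in> S \<Longrightarrow> vpoly (h a d)"
  shows "Dchi (\<lambda>d. vsum (\<lambda>a. vsmult (c a) (h a d)) S) = (\<lambda>d. vsum (\<lambda>a. vsmult (c a) (Dchi (h a) d)) S)"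
proof
  fix d
  have "DV (vsum (\<lambda>a. vsmult (c a) (h a d)) S) = vsum (\<lambda>a. vsmult (c a) (DV (h a d))) S" for d
    using DV_vsum[of S "\<lambda>a. vsmult (c a) (h a d)"] assms by (simp add: DV_vsmult cong: vsum_cong)
  then show "Dchi (\<lambda>d. vsum (\<lambda>a. vsmult (c a) (h a d)) S) d = vsum (\<lambda>a. vsmult (c a) (Dchi (h a) d)) S"
    by (auto simp: Dchi_def vsmult_vadd vsum_vadd vsum_vsmult[symmetric] mult_ac)
qed

text \<open>The sesquilinearity sign is (-1) to the power p(bar X) + 1, which is
  \<open>(-1) ^ p\<close>, and it is the same for all matrix units contributing to
  \<open>X\<close>.\<close>

lemma LBr_vgen_Suc:
  assumes "mhom n p X"
  shows "LBr n X (vgen (k, l, Suc m)) = csmult ((-1) ^ p) (Dchi (LBr n X (vgen (k, l, m))))"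
proof
  fix d
  have "LBr n X (vgen (k, l, Suc m)) d = vsum (\<lambda>a. vsmult ((-1) ^ p)
      (vsmult (X (fst a) (snd a)) (Dchi (brg n a (k, l, m)) d))) (Iset n \<times> Iset n)"
    unfolding LBr_vgen
  proof (rule vsum_cong[OF refl], clarify)
    fix i j assume ij: "i \<in> Iset n" "j \<in> Iset n"
    show "vsmult (X (fst (i, j)) (snd (i, j))) (brg n (i, j) (k, l, Suc m) d) = vsmult ((-1) ^ p)
      (vsmult (X (fst (i, j)) (snd (i, j))) (Dchi (brg n (i, j) (k, l, m)) d))"
    proof (cases "X i j = 0")
      case False
      then have "(-1::complex) ^ (par i + par j) = (-1) ^ p"
        using assms ij by (intro minus_one_power_cong) (auto simp: mhom_def)
      then show ?thesis
        by (simp add: brg_Suc csmult_def mult_ac)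
    qed simp
  qed
  also have "\<dots> = csmult ((-1) ^ p) (Dchi (\<lambda>d. LBr n X (vgen (k, l, m)) d)) d"
    unfolding LBr_vgen csmult_def by (subst Dchi_vsum) (auto simp: vsum_vsmult simp del: vsmult_simps)
  finally show "LBr n X (vgen (k, l, Suc m)) d = csmult ((-1) ^ p) (Dchi (LBr n X (vgen (k, l, m)))) d" .
qed

lemma LBr_barD_Suc:
  assumes "mhom n p X"
  shows "LBr n X (barD n (Suc m) Y) = csmult ((-1) ^ p) (Dchi (LBr n X (barD n m Y)))"
proof
  fix d
  have "LBr n X (barD n (Suc m) Y) d = vsum (\<lambda>b. vsmult ((-1) ^ p) (vsmult (Y (fst b) (snd b))
      (Dchi (LBr n X (vgen (fst b, snd b, m))) d))) (Iset n \<times> Iset n)"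
    unfolding LBr_barD LBr_vgen_Suc[OF assms] csmult_def by (simp add: mult_ac)
  also have "\<dots> = csmult ((-1) ^ p) (Dchi (\<lambda>d. LBr n X (barD n m Y) d)) d"
    unfolding LBr_barD csmult_def by (subst Dchi_vsum) (auto simp: vsum_vsmult simp del: vsmult_simps)
  finally show "LBr n X (barD n (Suc m) Y) d = csmult ((-1) ^ p) (Dchi (LBr n X (barD n m Y))) d" .
qed

lemma barV_outside: "(\<And>k l. k \<in> Iset n \<Longrightarrow> l \<in> Iset n \<Longrightarrow> X k l = 0) \<Longrightarrow> barD n m X = vzero"
  unfolding barD_def by (subst vsum_cong[where k = "\<lambda>_. vzero"]) auto

text \<open>The type of generators also contains triples with indices outside \<open>Iset n\<close>,
  and induction over all words meets them. Bracket and \<open>kappa\<close> both send them to zero,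
  so they do not disturb the comparison.\<close>

lemma LBr_vgen_outside:
  assumes X: "mhom n p X" and g: "k \<notin> Iset n \<or> l \<notin> Iset n"
  shows "LBr n X (vgen (k, l, m)) d = vzero"
proof (induction m arbitrary: d)
  case 0
  have "brg n (i, j) (k, l, 0) d = vzero" if "i \<in> Iset n" "j \<in> Iset n" for i j
  proof -
    have "barV n (brE i j k l) = vzero"
      by (rule barV_outside) (use that g in \<open>auto simp: brE_def E_def\<close>)
    moreover have "strf n (E i j) (E k l) = 0"
      using that g by (auto simp: strf_E)
    ultimately show ?thesis
      by (simp add: brg_0 br0_def)
  qed
  then have "vsum (\<lambda>a. vsmult (X (fst a) (snd a)) (brg n a (k, l, 0) d)) (Iset n \<times> Iset n) = vsum (\<lambda>a. vzero) (Iset n \<times> Iset n)"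
    by (intro vsum_cong) auto
  then show ?case
    by (simp add: LBr_vgen)
next
  case (Suc m)
  then show ?case
    by (simp add: LBr_vgen_Suc[OF X] csmult_def Dchi_def)
qed

lemma kgen_outside: "k \<notin> Iset n \<or> l \<notin> Iset n \<Longrightarrow> kgen n (k, l, m) = vzero"
  unfolding kgen_proj
proof (rule barV_outside)
  fix a b assume "k \<notin> Iset n \<or> l \<notin> Iset n" "a \<in> Iset n" "b \<in> Iset n"
  moreover from this have "prm n a \<in> Iset n" "prm n b \<in> Iset n"
    by simp_all
  ultimately show "proj n (E k l) a b = 0"
    by (auto simp: proj_def theta_def E_def)
qed

section \<open>Compatibility of the projection with the bracket\<close>

lemma sum_pairs: "(\<Sum>b\<in>S \<times> T. h (fst b) (snd b)) = (\<Sum>u\<in>S. \<Sum>v\<in>T. h u v)"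
  by (simp add: sum.cartesian_product case_prod_unfold)

lemma sbr_expand:
  assumes X: "mhom n p X" and Y: "mhom n q Y" and kl: "k \<in> Iset n" "l \<in> Iset n"
  shows "(\<Sum>b\<in>Iset n \<times> Iset n. Y (fst b) (snd b) *
    (\<Sum>a\<in>Iset n \<times> Iset n. X (fst a) (snd a) * brE (fst a) (snd a) (fst b) (snd b) k l)) = sbr n p q X Y k l"
proof -
  let ?I = "Iset n" and ?s = "(-1::complex) ^ (p * q)"
  have inner: "Y u v * (\<Sum>a\<in>?I \<times> ?I. X (fst a) (snd a) * brE (fst a) (snd a) u v k l)
     = (if v = l then X k u * Y u v else 0) - ?s * (if u = k then Y u v * X v l else 0)"
    if uv: "u \<in> ?I" "v \<in> ?I" for u v
  proof (cases "Y u v = 0")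
    case False
    then have qv: "even (par u + par v + q)"
      using Y uv by (auto simp: mhom_def)
    \<comment> \<open>With (u, v) and the entry (k, l) fixed, only the matrix units at (k, u) and
      (v, l) can contribute, one for each term of the commutator.\<close>
    have "(\<Sum>a\<in>?I \<times> ?I. X (fst a) (snd a) * brE (fst a) (snd a) u v k l)
      = (\<Sum>a\<in>?I \<times> ?I. (if a = (k, u) then (if v = l then X k u else 0) else 0)
          - ?s * (if a = (v, l) then (if u = k then X v l else 0) else 0))"
    proof (intro sum.cong refl, clarify)
      fix i j assume ij: "i \<in> ?I" "j \<in> ?I"
      show "X (fst (i, j)) (snd (i, j)) * brE (fst (i, j)) (snd (i, j)) u v k l
        = (if (i, j) = (k, u) then (if v = l then X k u else 0) else 0)
          - ?s * (if (i, j) = (v, l) then (if u = k then X v l else 0) else 0)"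
      proof (cases "X i j = 0")
        case False
        then have "even (par i + par j + p)"
          using X ij by (auto simp: mhom_def)
        then have "(-1::complex) ^ ((par i + par j) * (par u + par v)) = ?s"
          using qv by (intro minus_one_power_cong) auto
        then show ?thesis
          by (auto simp: brE_def E_def)
      qed auto
    qed
    also have "\<dots> = (if v = l then X k u else 0) - ?s * (if u = k then X v l else 0)"
      unfolding sum_subtractf sum_distrib_left[symmetric] using uv kl by simp
    finally have e: "(\<Sum>a\<in>?I \<times> ?I. X (fst a) (snd a) * brE (fst a) (snd a) u v k l)
      = (if v = l then X k u else 0) - ?s * (if u = k then X v l else 0)" .
    show ?thesis
      unfolding e by (auto simp: algebra_simps)
  qed auto
  have "(\<Sum>b\<in>?I \<times> ?I. Y (fst b) (snd b) *
    (\<Sum>a\<in>?I \<times> ?I. X (fst a) (snd a) * brE (fst a) (snd a) (fst b) (snd b) k l))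
    = (\<Sum>b\<in>?I \<times> ?I. (if snd b = l then X k (fst b) * Y (fst b) (snd b) else 0)
         - ?s * (if fst b = k then Y (fst b) (snd b) * X (snd b) l else 0))"
    by (intro sum.cong refl inner) auto
  also have "\<dots> = (\<Sum>u\<in>?I. \<Sum>v\<in>?I. if v = l then X k u * Y u v else 0)
      - ?s * (\<Sum>u\<in>?I. \<Sum>v\<in>?I. if u = k then Y u v * X v l else 0)"
    unfolding sum_subtractf sum_distrib_left[symmetric]
      sum_pairs[of "\<lambda>u v. if v = l then X k u * Y u v else 0"]
      sum_pairs[of "\<lambda>u v. if u = k then Y u v * X v l else 0"] ..
  also have "(\<Sum>u\<in>?I. \<Sum>v\<in>?I. if u = k then Y u v * X v l else 0)
      = (\<Sum>v\<in>?I. \<Sum>u\<in>?I. if u = k then Y u v * X v l else 0)"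
    by (rule sum.swap)
  finally show ?thesis
    using kl by (simp add: sbr_def)
qed

lemma strf_expand:
  "(\<Sum>b\<in>Iset n \<times> Iset n. Y (fst b) (snd b) *
    (\<Sum>a\<in>Iset n \<times> Iset n. X (fst a) (snd a) * strf n (E (fst a) (snd a)) (E (fst b) (snd b)))) = strf n X Y"
proof -
  let ?I = "Iset n"
  have inner: "(\<Sum>a\<in>?I \<times> ?I. X (fst a) (snd a) * strf n (E (fst a) (snd a)) (E u v)) = (-1) ^ par v * X v u"
    if uv: "u \<in> ?I" "v \<in> ?I" for u v
  proof -
    have "(\<Sum>a\<in>?I \<times> ?I. X (fst a) (snd a) * strf n (E (fst a) (snd a)) (E u v))
      = (\<Sum>a\<in>?I \<times> ?I. if a = (v, u) then (-1) ^ par v * X v u else 0)"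
      by (intro sum.cong refl) (auto simp: strf_E)
    then show ?thesis
      using uv by simp
  qed
  have "(\<Sum>b\<in>?I \<times> ?I. Y (fst b) (snd b) *
    (\<Sum>a\<in>?I \<times> ?I. X (fst a) (snd a) * strf n (E (fst a) (snd a)) (E (fst b) (snd b))))
    = (\<Sum>b\<in>?I \<times> ?I. (-1) ^ par (snd b) * (X (snd b) (fst b) * Y (fst b) (snd b)))"
    by (intro sum.cong refl) (auto simp: inner)
  also have "\<dots> = (\<Sum>u\<in>?I. \<Sum>v\<in>?I. (-1) ^ par v * (X v u * Y u v))"
    by (rule sum_pairs)
  also have "\<dots> = (\<Sum>v\<in>?I. \<Sum>u\<in>?I. (-1) ^ par v * (X v u * Y u v))"
    by (rule sum.swap)
  finally show ?thesis
    by (simp add: strf_def sum_distrib_left)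
qed

text \<open>The defining bracket, known on matrix units, is recovered for all homogeneous matrices;
  in this form it applies to \<open>Y\<close> and to \<open>proj n Y\<close> alike.\<close>

lemma LBr_barV:
  assumes X: "mhom n p X" and Y: "mhom n q Y"
  shows "LBr n X (barV n Y) d = (if d = 0 then vsmult ((-1) ^ (p * (q + 1))) (barV n (sbr n p q X Y))
    else if d = 1 then vsmult (strf n X Y) vone else vzero)"
proof -
  let ?I = "Iset n \<times> Iset n"
  have L: "LBr n X (barV n Y) d = vsum (\<lambda>b. vsmult (Y (fst b) (snd b))
      (vsum (\<lambda>a. vsmult (X (fst a) (snd a)) (br0 n a b d)) ?I)) ?I"
    unfolding LBr_barD LBr_vgen brg_0 by simp
  consider "d = 0" | "d = 1" | "d \<ge> 2"
    by linarith
  then show ?thesis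
  proof cases
    case 1
    have "vsmult (Y (fst b) (snd b)) (vsum (\<lambda>a. vsmult (X (fst a) (snd a)) (br0 n a b 0)) ?I)
      = vsmult ((-1) ^ (p * (q + 1))) (vsmult (Y (fst b) (snd b))
          (vsum (\<lambda>a. vsmult (X (fst a) (snd a)) (barV n (brE (fst a) (snd a) (fst b) (snd b)))) ?I))"
      if b: "b \<in> ?I" for b
    proof (cases "Y (fst b) (snd b) = 0")
      case False
      then have qb: "even (par (fst b) + par (snd b) + q)"
        using b Y by (auto simp: mhom_def)
      have "vsum (\<lambda>a. vsmult (X (fst a) (snd a)) (br0 n a b 0)) ?I
        = vsum (\<lambda>a. vsmult ((-1) ^ (p * (q + 1))) (vsmult (X (fst a) (snd a)) (barV n (brE (fst a) (snd a) (fst b) (snd b))))) ?I"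
      proof (rule vsum_cong[OF refl], clarify)
        fix i j assume ij: "i \<in> Iset n" "j \<in> Iset n"
        show "vsmult (X (fst (i, j)) (snd (i, j))) (br0 n (i, j) b 0) = vsmult ((-1) ^ (p * (q + 1)))
          (vsmult (X (fst (i, j)) (snd (i, j))) (barV n (brE (fst (i, j)) (snd (i, j)) (fst b) (snd b))))"
        proof (cases "X i j = 0")
          case False
          then have "even (par i + par j + p)"
            using X ij by (auto simp: mhom_def)
          then have "(-1::complex) ^ ((par i + par j) * (par (fst b) + par (snd b) + 1)) = (-1) ^ (p * (q + 1))"
            using qb by (intro minus_one_power_cong) auto
          then show ?thesis
            by (cases b) (simp add: br0_def mult_ac)
        qed simp
      qed
      then show ?thesis
        by (simp only: vsum_vsmult) (simp add: mult.commute)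
    qed simp
    then have "LBr n X (barV n Y) d = vsum (\<lambda>b. vsmult ((-1) ^ (p * (q + 1))) (vsmult (Y (fst b) (snd b))
          (vsum (\<lambda>a. vsmult (X (fst a) (snd a)) (barV n (brE (fst a) (snd a) (fst b) (snd b)))) ?I))) ?I"
      unfolding L unfolding 1 by (rule vsum_cong[OF refl])
    also have "\<dots> = vsmult ((-1) ^ (p * (q + 1))) (barV n (\<lambda>k l. \<Sum>b\<in>?I. Y (fst b) (snd b) *
        (\<Sum>a\<in>?I. X (fst a) (snd a) * brE (fst a) (snd a) (fst b) (snd b) k l)))"
      unfolding barD_vsum vsum_vsmult ..
    also have "barV n (\<lambda>k l. \<Sum>b\<in>?I. Y (fst b) (snd b) *
        (\<Sum>a\<in>?I. X (fst a) (snd a) * brE (fst a) (snd a) (fst b) (snd b) k l)) = barV n (sbr n p q X Y)"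
      by (rule barD_cong) (rule sbr_expand[OF X Y])
    finally show ?thesis
      using 1 by simp
  next
    case 2
    have "br0 n a b 1 = vsmult (strf n (E (fst a) (snd a)) (E (fst b) (snd b))) vone" for a b
      by (simp add: br0_def case_prod_unfold)
    then have "LBr n X (barV n Y) d = vsmult (\<Sum>b\<in>?I. Y (fst b) (snd b) *
        (\<Sum>a\<in>?I. X (fst a) (snd a) * strf n (E (fst a) (snd a)) (E (fst b) (snd b)))) vone"
      unfolding L unfolding 2 by (simp add: v_defs sum_distrib_left sum_distrib_right mult_ac)
    then show ?thesis
      unfolding strf_expand using 2 by simp
  next
    case 3
    have "br0 n a b d = vzero" for a b
      using 3 by (auto simp: br0_def case_prod_unfold)
    then show ?thesis
      unfolding L using 3 by simp
  qed
qed

lemma kappa_Dchi: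
  assumes "\<And>d. vpoly (u d)"
  shows "kappa n (Dchi u d) = Dchi (\<lambda>d. kappa n (u d)) d"
  using assms by (simp add: Dchi_def kappa_vadd kappa_vsmult kappa_DV)

text \<open>At \<open>m = 0\<close> the chi^0 coefficient is settled by \<open>proj_sbr\<close> and
  the chi^1 coefficient by \<open>strf_proj\<close>; higher \<open>m\<close> follow because
  \<open>kappa\<close> commutes with D + chi.\<close>

lemma kappa_LBr_barD:
  assumes X: "X \<in> osp n" "mhom n p X" and Y: "mhom n q Y"
  shows "kappa n (LBr n X (barD n m Y) d) = LBr n X (barD n m (proj n Y)) d"
proof (induction m arbitrary: d)
  case 0
  have "barV n (proj n (sbr n p q X Y)) = barV n (sbr n p q X (proj n Y))"
    by (rule barD_cong) (rule proj_sbr[OF X Y])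
  then show ?case
    unfolding LBr_barV[OF X(2) Y] LBr_barV[OF X(2) mhom_proj[OF Y]]
    by (simp add: kappa_vsmult kappa_barD strf_proj[OF X(1)])
next
  case (Suc m)
  then show ?case
    by (simp add: LBr_barD_Suc[OF X(2)] csmult_def kappa_vsmult kappa_Dchi)
qed

lemma barD_E: "k \<in> Iset n \<Longrightarrow> l \<in> Iset n \<Longrightarrow> barD n m (E k l) = vgen (k, l, m)"
proof -
  assume kl: "k \<in> Iset n" "l \<in> Iset n"
  have "(\<Sum>(i, j)\<in>Iset n \<times> Iset n. E k l i j * vgen (i, j, m) M)
      = (\<Sum>p\<in>Iset n \<times> Iset n. if p = (k, l) then vgen (k, l, m) M else 0)" for M
    by (rule sum.cong) (auto simp: E_def split: if_splits)
  then show ?thesis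
    using kl by (auto simp: barD_def v_defs case_prod_unfold)
qed

lemma kappa_LBr_homogeneous:
  assumes X: "X \<in> osp n" "mhom n p X" and "vpoly w"
  shows "kappa n (LBr n X w d) = LBr n X (kappa n w) d"
  using assms(3)
proof (induction rule: vpoly_induct)
  case (prodl gs)
  show ?case
  proof (induction gs)
    case (Cons g gs)
    obtain k l m where g: "g = (k, l, m)"
      by (cases g)
    have gen: "kappa n (LBr n X (vgen g) d) = LBr n X (kgen n g) d"
    proof (cases "k \<in> Iset n \<and> l \<in> Iset n")
      case True
      then show ?thesis
        using kappa_LBr_barD[OF X mhom_E, of m k l d] by (simp add: g kgen_proj barD_E)
    next
      case False
      then show ?thesis
        using LBr_vgen_outside[OF X(2), of k l m d] kgen_outside[of k n l m] by (simp add: g)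
    qed
    have "kappa n (LBr n X (prodl (g # gs)) d)
      = vadd (vsmult ((-1) ^ ((p + d) * gpar g)) (vmult (kgen n g) (LBr n X (kl n gs) d)))
         (vmult (LBr n X (kgen n g) d) (kl n gs))"
      using Cons by (simp add: LBr_vmult_vgen[OF X(2)] kappa_vadd kappa_vsmult kappa_vmult kappa_vgen gen kappa_prodl)
    also have "\<dots> = LBr n X (vmult (kgen n g) (kl n gs)) d"
      using LBr_vmult_barD[of n p X "par k + par l" "proj n (E k l)" "kl n gs" m d,
          OF X(2) mhom_proj[OF mhom_E] vpoly_kl]
      by (simp add: g kgen_proj gpar_def)
    finally show ?case
      by (simp add: kappa_vmult kappa_vgen kappa_prodl)
  qed simp
qed (simp_all add: LBr_vadd LBr_vsmult kappa_vadd kappa_vsmult)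

text \<open>Elements of the positive part may mix parities, whereas the Leibniz and bracket formulas
  require a homogeneous \<open>X\<close>.\<close>

definition parity_part :: "nat \<Rightarrow> mat \<Rightarrow> mat" where
  "parity_part p X = (\<lambda>i j. if even (par i + par j + p) then X i j else 0)"

text \<open>Priming keeps the parity of an index, so theta commutes with taking parity
  parts.\<close>

lemma parity_part_osp: "X \<in> osp n \<Longrightarrow> parity_part p X \<in> osp n"
proof -
  assume X: "X \<in> osp n"
  have "theta n (parity_part p X) k l = parity_part p (theta n X) k l" for k l
    by (auto simp: theta_def parity_part_def add.commute)
  then have "theta n (parity_part p X) = parity_part p X"
    using X unfolding osp_def by (intro ext) simp
  moreover have "parity_part p X \<in> gl n"
    using X by (auto simp: osp_def gl_def parity_part_def)
  ultimately show ?thesis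
    by (simp add: osp_def)
qed

lemma kappa_LBr:
  assumes "X \<in> osp n" "vpoly w"
  shows "kappa n (LBr n X w d) = LBr n X (kappa n w) d"
proof -
  have mhom: "mhom n p (parity_part p X)" for p
    by (auto simp: mhom_def parity_part_def split: if_splits)
  have X: "X = (\<lambda>i j. parity_part 0 X i j + parity_part 1 X i j)"
    by (auto simp: parity_part_def fun_eq_iff)
  show ?thesis
    by (subst (1 2) X)
      (simp add: LBr_add_left kappa_vadd kappa_LBr_homogeneous[OF parity_part_osp[OF assms(1)] mhom assms(2)])
qed

section \<open>Images of the generated subalgebras and of the ideal\<close>

lemma vpoly_Valg: "P \<in> Valg n A \<Longrightarrow> vpoly P"
  unfolding Valg_def by (induction rule: subalg.induct) auto

lemma kappa_Valg:
  assumes "P \<in> Valg n A" and AB: "\<And>X. X \<in> A \<Longrightarrow> proj n X \<in> B"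
  shows "kappa n P \<in> Valg n B"
  using assms(1) unfolding Valg_def
proof (induction rule: subalg.induct)
  case (sa_gen s)
  then obtain m X where "s = barD n m X" "X \<in> A"
    by blast
  then have "kappa n s \<in> {barD n m X | m X. X \<in> B}"
    using AB kappa_barD by blast
  then show ?case
    by (rule subalg.sa_gen)
next
  case (sa_add x y)
  then show ?case
    by (simp add: kappa_vadd vpoly_Valg[unfolded Valg_def] subalg.sa_add)
next
  case (sa_smult x c)
  then show ?case
    by (simp add: kappa_vsmult vpoly_Valg[unfolded Valg_def] subalg.sa_smult)
next
  case (sa_mult x y)
  then show ?case
    by (simp add: kappa_vmult vpoly_Valg[unfolded Valg_def] subalg.sa_mult)
qed (simp add: subalg.sa_one)

lemma vpoly_Jid: "P \<in> Jid n A N \<Longrightarrow> vpoly P"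
  unfolding Jid_def by (induction rule: dideal.induct) (auto dest: vpoly_Valg)

text \<open>This is what lets \<open>strf_proj\<close> be applied to \<open>f\<close>; each summand
  is fixed because theta is an involution on \<open>gl n\<close>.\<close>

lemma fnil_osp: "fnil n \<in> osp n"
proof -
  have E: "E (i + 1) i \<in> gl n" if "i \<in> {1..2 * n}" for i
    using that by (auto simp: gl_def E_def Iset_def)
  have "theta n (F n (i + 1) i) = F n (i + 1) i" if "i \<in> {1..2 * n}" for i
  proof (intro ext)
    fix k l
    have "theta n (F n (i + 1) i) k l = theta n (E (i + 1) i) k l + theta n (theta n (E (i + 1) i)) k l"
      by (simp add: theta_def F_def algebra_simps)
    then show "theta n (F n (i + 1) i) k l = F n (i + 1) i k l"
      using theta_theta[OF E[OF that]] by (simp add: F_def)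
  qed
  moreover have "theta n (fnil n) k l = (\<Sum>i\<in>{1..2 * n}. theta n (F n (i + 1) i) k l)" for k l
    by (auto simp: theta_def fnil_def sum_distrib_left)
  ultimately have "theta n (fnil n) = fnil n"
    by (simp add: fnil_def fun_eq_iff)
  then show ?thesis
    using theta_in_gl[of n "fnil n"] by (simp add: osp_def)
qed

lemma kappa_Jid:
  assumes "P \<in> Jid n (gl n) (posPart n (gl n))"
  shows "kappa n P \<in> Jid n (osp n) (posPart n (osp n))"
proof -
  note vJ = vpoly_Jid[unfolded Jid_def]
  have Valg: "kappa n a \<in> Valg n (osp n)" if "a \<in> Valg n (gl n)" for a
    using that proj_osp by (rule kappa_Valg)
  show ?thesis
    using assms unfolding Jid_def
  proof (induction rule: dideal.induct)
    case (di_gen g)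
    then obtain X where X: "X \<in> posPart n (gl n)" "g = vadd (barV n X) (vsmult (- strf n (fnil n) X) vone)"
      by blast
    then have "kappa n g = vadd (barV n (proj n X)) (vsmult (- strf n (fnil n) (proj n X)) vone)"
      by (simp add: kappa_vadd kappa_vsmult kappa_barD strf_proj[OF fnil_osp])
    then show ?case
      using proj_posPart[OF X(1)] by (auto intro!: dideal.di_gen)
  next
    case di_zero
    then show ?case
      by (simp add: dideal.di_zero)
  next
    case (di_add x y)
    then show ?case
      by (simp add: kappa_vadd vJ dideal.di_add)
  next
    case (di_lmult a x)
    then show ?case
      by (simp add: kappa_vmult vJ vpoly_Valg Valg dideal.di_lmult)
  next
    case (di_rmult a x)
    then show ?case
      by (simp add: kappa_vmult vJ vpoly_Valg Valg dideal.di_rmult)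
  next
    case (di_D x)
    then show ?case
      by (simp add: kappa_DV vJ dideal.di_D)
  qed
qed

theorem mainTheorem7:
  fixes n :: nat and w :: V
  assumes "n \<ge> 1"
    and "w \<in> Wset n (gl n)"
  shows "kappa n w \<in> Wset n (osp n)"
proof -
  have w: "w \<in> Valg n (nonposPart n (gl n))"
    and J: "\<And>X d. X \<in> posPart n (gl n) \<Longrightarrow> LBr n X w d \<in> Jid n (gl n) (posPart n (gl n))"
    using assms(2) by (auto simp: Wset_def)
  have "LBr n X (kappa n w) d \<in> Jid n (osp n) (posPart n (osp n))" if "X \<in> posPart n (osp n)" for X d
  proof -
    have "X \<in> posPart n (gl n)" "X \<in> osp n"
      using that by (auto simp: posPart_def osp_def)
    then show ?thesis
      using kappa_Jid[OF J] kappa_LBr[OF _ vpoly_Valg[OF w]] by metis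
  qed
  moreover have "kappa n w \<in> Valg n (nonposPart n (osp n))"
    using w proj_nonposPart by (rule kappa_Valg)
  ultimately show ?thesis
    by (simp add: Wset_def)
qed

end
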